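(* Let $F$ be an (infinite dimensional, separable) $1$-homogeneous $1$-Hilbertian operator space. Then $$\Phi_{c,F}(n)\,\Phi_{c,F^*}(n)=n\quad\text{and}\quad\Phi_{r,F}(n)\,\Phi_{r,F^*}(n)=n\qquad\text{for all }n\in\mathbb N.$$
   Context: An operator space $F$ is $1$-homogeneous if every bounded linear map $u$ on $F$ is completely bounded with $\|u\|_{cb}\le\|u\|$, and $1$-Hilbertian if it is isometric to a Hilbert space as a Banach space. $F^*$ is the operator space dual (again $1$-homogeneous and $1$-Hilbertian). $C=\overline{\mathrm{span}}\{e_{k1}\}$ and $R=\overline{\mathrm{span}}\{e_{1k}\}$ are the column and row operator subspaces of $B(\ell_2)$. The fundamental functions are $\Phi_{c,F}(n)=\|\sum_{k=1}^ne_{k1}\otimes e_k\|^2_{C\otimes_{\min}F}$ and $\Phi_{r,F}(n)=\|\sum_{k=1}^ne_{1k}\otimes e_k\|^2_{R\otimes_{\min}F}$, where $(e_k)$ is an orthonormal basis of $F$. *)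

theory Defs
  imports "HOL-Analysis.Analysis"
begin

section \<open>Complex Hilbert spaces\<close>

text \<open>The real inner product inherited from \<^class>\<open>real_inner\<close> is the real part of
  the complex one, so norm and topology are those of the library. The complex inner product is
  antilinear in its first argument.\<close>

class chilbert_space = real_inner + complete_space +
  fixes scaleC :: "complex \<Rightarrow> 'a \<Rightarrow> 'a" (infixr "*\<^sub>C" 75)
    and cinner :: "'a \<Rightarrow> 'a \<Rightarrow> complex"
  assumes scaleC_add_right: "c *\<^sub>C (x + y) = c *\<^sub>C x + c *\<^sub>C y"
    and scaleC_add_left: "(c + d) *\<^sub>C x = c *\<^sub>C x + d *\<^sub>C x"
    and scaleC_scaleC: "c *\<^sub>C d *\<^sub>C x = (c * d) *\<^sub>C x"
    and scaleC_of_real: "complex_of_real r *\<^sub>C x = r *\<^sub>R x"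
    and cinner_commute: "cinner x y = cnj (cinner y x)"
    and cinner_add_right: "cinner x (y + z) = cinner x y + cinner x z"
    and cinner_scaleC_right: "cinner x (c *\<^sub>C y) = c * cinner x y"
    and Re_cinner: "Re (cinner x y) = inner x y"

lemma cinner_self: "cinner x x = complex_of_real ((norm x)\<^sup>2)" for x :: "'h::chilbert_space"
proof (rule complex_eqI)
  show "Re (cinner x x) = Re (complex_of_real ((norm x)\<^sup>2))"
    by (simp add: Re_cinner power2_norm_eq_inner)
  have "Im (cinner x x) = - Im (cinner x x)"
    by (subst cinner_commute) simp
  then show "Im (cinner x x) = Im (complex_of_real ((norm x)\<^sup>2))"
    by simp
qed

lemma cinner_scaleC_left: "cinner (c *\<^sub>C x) y = cnj c * cinner x y"
  for x y :: "'h::chilbert_space"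
  by (metis cinner_commute cinner_scaleC_right complex_cnj_mult)

lemma norm_scaleC: "norm (c *\<^sub>C x) = cmod c * norm x" for x :: "'h::chilbert_space"
proof -
  have "cinner (c *\<^sub>C x) (c *\<^sub>C x) = (c * cnj c) * cinner x x"
    by (simp add: cinner_scaleC_left cinner_scaleC_right mult.left_commute mult.assoc)
  then have "complex_of_real ((norm (c *\<^sub>C x))\<^sup>2) = complex_of_real ((cmod c * norm x)\<^sup>2)"
    unfolding cinner_self complex_norm_square[symmetric]
    by (simp only: of_real_mult of_real_power power_mult_distrib)
  then have "(norm (c *\<^sub>C x))\<^sup>2 = (cmod c * norm x)\<^sup>2"
    using of_real_eq_iff by blast
  then show ?thesis
    by (simp add: power2_eq_iff_nonneg)
qed

lemma bounded_linear_scaleC: "bounded_linear (\<lambda>x :: 'h::chilbert_space. c *\<^sub>C x)"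
proof (rule bounded_linear_intro[where K = "cmod c"])
  fix r and x :: 'h
  show "c *\<^sub>C r *\<^sub>R x = r *\<^sub>R c *\<^sub>C x"
    by (simp add: scaleC_of_real[symmetric] scaleC_scaleC mult.commute)
qed (simp_all add: scaleC_add_right norm_scaleC mult.commute)

lemma cinner_bound: "cmod (cinner x y) \<le> norm x * norm y" for x y :: "'h::chilbert_space"
proof (cases "cinner x y = 0")
  case False
  define c where "c = cnj (cinner x y) / cmod (cinner x y)"
  have c: "cmod c = 1"
    using False by (simp add: c_def norm_divide)
  have "c * cinner x y = complex_of_real (cmod (cinner x y))"
    using False by (simp add: c_def complex_norm_square[symmetric] mult.commute power2_eq_square)
  then have "cmod (cinner x y) = inner x (c *\<^sub>C y)"
    by (metis Re_cinner Re_complex_of_real cinner_scaleC_right)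
  also have "\<dots> \<le> norm x * norm (c *\<^sub>C y)"
    by (rule norm_cauchy_schwarz)
  finally show ?thesis
    by (simp add: norm_scaleC c)
qed simp


section \<open>The Hilbert space \<open>\<ell>\<^sub>2\<close>\<close>

typedef ell2 = "{f :: nat \<Rightarrow> complex. summable (\<lambda>k. (cmod (f k))\<^sup>2)}"
  by (rule exI[of _ "\<lambda>_. 0"]) simp

setup_lifting type_definition_ell2

lemma ell2_summable_mult:
  fixes f g :: "nat \<Rightarrow> complex"
  assumes "summable (\<lambda>k. (cmod (f k))\<^sup>2)" "summable (\<lambda>k. (cmod (g k))\<^sup>2)"
  shows "summable (\<lambda>k. cnj (f k) * g k)"
proof (rule summable_comparison_test')
  show "summable (\<lambda>k. (cmod (f k))\<^sup>2 + (cmod (g k))\<^sup>2)"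
    using assms by (rule summable_add)
  fix k
  have "0 \<le> (cmod (f k) - cmod (g k))\<^sup>2" "0 \<le> cmod (f k) * cmod (g k)"
    by simp_all
  then show "norm (cnj (f k) * g k) \<le> (cmod (f k))\<^sup>2 + (cmod (g k))\<^sup>2"
    unfolding power2_diff norm_mult complex_mod_cnj by linarith
qed

lemma ell2_summable_add:
  fixes f g :: "nat \<Rightarrow> complex"
  assumes "summable (\<lambda>k. (cmod (f k))\<^sup>2)" "summable (\<lambda>k. (cmod (g k))\<^sup>2)"
  shows "summable (\<lambda>k. (cmod (f k + g k))\<^sup>2)"
proof (rule summable_comparison_test')
  show "summable (\<lambda>k. 2 * ((cmod (f k))\<^sup>2 + (cmod (g k))\<^sup>2))"
    using assms by (intro summable_mult summable_add)
  fix k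
  have "(cmod (f k + g k))\<^sup>2 \<le> (cmod (f k) + cmod (g k))\<^sup>2"
    by (intro power_mono norm_triangle_ineq) simp
  moreover have "0 \<le> (cmod (f k) - cmod (g k))\<^sup>2"
    by simp
  ultimately show "norm ((cmod (f k + g k))\<^sup>2) \<le> 2 * ((cmod (f k))\<^sup>2 + (cmod (g k))\<^sup>2)"
    unfolding power2_diff power2_sum by (simp del: zero_le_power2)
qed

lemma ell2_summable_scale:
  "summable (\<lambda>k. (cmod (f k))\<^sup>2) \<Longrightarrow> summable (\<lambda>k. (cmod (c * f k))\<^sup>2)"
  for f :: "nat \<Rightarrow> complex"
  by (simp add: norm_mult power_mult_distrib summable_mult)

lift_definition ell2_cinner :: "ell2 \<Rightarrow> ell2 \<Rightarrow> complex" is "\<lambda>f g. \<Sum>k. cnj (f k) * g k" .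

instantiation ell2 :: real_vector
begin

lift_definition zero_ell2 :: ell2 is "\<lambda>_. 0" by simp
lift_definition plus_ell2 :: "ell2 \<Rightarrow> ell2 \<Rightarrow> ell2" is "\<lambda>f g k. f k + g k"
  by (rule ell2_summable_add)
lift_definition uminus_ell2 :: "ell2 \<Rightarrow> ell2" is "\<lambda>f k. - f k" by simp
lift_definition minus_ell2 :: "ell2 \<Rightarrow> ell2 \<Rightarrow> ell2" is "\<lambda>f g k. f k - g k"
  subgoal for f g using ell2_summable_add[of f "\<lambda>k. - g k"] by simp
  done
lift_definition scaleR_ell2 :: "real \<Rightarrow> ell2 \<Rightarrow> ell2" is "\<lambda>r f k. complex_of_real r * f k"
  by (rule ell2_summable_scale)

instance
  by standard (transfer; simp add: fun_eq_iff algebra_simps)+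

end

lemma ell2_cinner_add_right: "ell2_cinner x (y + z) = ell2_cinner x y + ell2_cinner x z"
  by transfer (simp add: distrib_left suminf_add ell2_summable_mult)

lemma ell2_cinner_commute: "ell2_cinner x y = cnj (ell2_cinner y x)"
proof transfer
  fix f g :: "nat \<Rightarrow> complex"
  assume "summable (\<lambda>k. (cmod (f k))\<^sup>2)" "summable (\<lambda>k. (cmod (g k))\<^sup>2)"
  then have "(\<lambda>k. cnj (g k) * f k) sums (\<Sum>k. cnj (g k) * f k)"
    by (intro summable_sums ell2_summable_mult)
  then have "(\<lambda>k. cnj (cnj (g k) * f k)) sums cnj (\<Sum>k. cnj (g k) * f k)"
    by (simp only: sums_cnj)
  then show "(\<Sum>k. cnj (f k) * g k) = cnj (\<Sum>k. cnj (g k) * f k)"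
    by (simp add: sums_iff mult.commute)
qed

lemma ell2_cinner_self:
  "ell2_cinner x x = complex_of_real (\<Sum>k. (cmod (Rep_ell2 x k))\<^sup>2)"
proof transfer
  fix f :: "nat \<Rightarrow> complex"
  assume "summable (\<lambda>k. (cmod (f k))\<^sup>2)"
  then have "(\<lambda>k. complex_of_real ((cmod (f k))\<^sup>2)) sums complex_of_real (\<Sum>k. (cmod (f k))\<^sup>2)"
    by (intro sums_of_real summable_sums)
  then show "(\<Sum>k. cnj (f k) * f k) = complex_of_real (\<Sum>k. (cmod (f k))\<^sup>2)"
    by (simp add: sums_iff complex_norm_square mult.commute del: of_real_power)
qed

lemma ell2_summable: "summable (\<lambda>k. (cmod (Rep_ell2 x k))\<^sup>2)"
  using Rep_ell2[of x] by simp

instantiation ell2 :: real_inner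
begin

definition inner_ell2 :: "ell2 \<Rightarrow> ell2 \<Rightarrow> real" where
  "inner_ell2 x y = Re (ell2_cinner x y)"
definition norm_ell2 :: "ell2 \<Rightarrow> real" where
  "norm_ell2 x = sqrt (inner x x)"
definition sgn_ell2 :: "ell2 \<Rightarrow> ell2" where
  "sgn_ell2 x = inverse (norm x) *\<^sub>R x"
definition dist_ell2 :: "ell2 \<Rightarrow> ell2 \<Rightarrow> real" where
  "dist_ell2 x y = norm (x - y)"
definition uniformity_ell2 :: "(ell2 \<times> ell2) filter" where
  "uniformity_ell2 = (INF e\<in>{0<..}. principal {(x, y). dist x y < e})"
definition open_ell2 :: "ell2 set \<Rightarrow> bool" where
  "open_ell2 U = (\<forall>x\<in>U. \<forall>\<^sub>F (x', y) in uniformity. x' = x \<longrightarrow> y \<in> U)"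

instance
proof
  fix x y z :: ell2 and r :: real
  show "inner x y = inner y x"
    unfolding inner_ell2_def by (subst ell2_cinner_commute) simp
  show "inner (x + y) z = inner x z + inner y z"
    unfolding inner_ell2_def
    by (metis ell2_cinner_add_right ell2_cinner_commute complex_cnj_add plus_complex.simps(1))
  have "ell2_cinner (r *\<^sub>R x) y = of_real r * ell2_cinner x y"
  proof transfer
    fix r :: real and f g :: "nat \<Rightarrow> complex"
    assume "summable (\<lambda>k. (cmod (f k))\<^sup>2)" "summable (\<lambda>k. (cmod (g k))\<^sup>2)"
    then have "summable (\<lambda>k. cnj (f k) * g k)"
      by (rule ell2_summable_mult)
    then show "(\<Sum>k. cnj (complex_of_real r * f k) * g k) = of_real r * (\<Sum>k. cnj (f k) * g k)"
      by (simp add: suminf_mult[symmetric] mult.assoc)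
  qed
  then show "inner (r *\<^sub>R x) y = r * inner x y"
    by (simp add: inner_ell2_def)
  show "0 \<le> inner x x"
    by (simp add: inner_ell2_def ell2_cinner_self suminf_nonneg ell2_summable)
  have "inner x x = 0 \<longleftrightarrow> (\<forall>k. Rep_ell2 x k = 0)"
    using suminf_eq_zero_iff[OF ell2_summable[of x]]
    by (simp add: inner_ell2_def ell2_cinner_self)
  also have "\<dots> \<longleftrightarrow> x = 0"
    by (simp add: Rep_ell2_inject[symmetric] zero_ell2.rep_eq fun_eq_iff)
  finally show "inner x x = 0 \<longleftrightarrow> x = 0" .
qed (rule norm_ell2_def sgn_ell2_def dist_ell2_def uniformity_ell2_def open_ell2_def)+

end

lemma norm_ell2_eq: "(norm x)\<^sup>2 = (\<Sum>k. (cmod (Rep_ell2 x k))\<^sup>2)" for x :: ell2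
  by (simp add: power2_norm_eq_inner inner_ell2_def ell2_cinner_self)

lemma sum_le_norm_ell2: "(\<Sum>k<N. (cmod (Rep_ell2 x k))\<^sup>2) \<le> (norm x)\<^sup>2"
  unfolding norm_ell2_eq by (rule sum_le_suminf) (auto simp: ell2_summable)

lemma Rep_ell2_diff: "Rep_ell2 (x - y) k = Rep_ell2 x k - Rep_ell2 y k"
  by (simp add: minus_ell2.rep_eq)

lemma cmod_le_norm_ell2: "cmod (Rep_ell2 x k) \<le> norm x"
proof -
  have "(cmod (Rep_ell2 x k))\<^sup>2 \<le> (\<Sum>k<Suc k. (cmod (Rep_ell2 x k))\<^sup>2)"
    by (rule member_le_sum) auto
  also have "\<dots> \<le> (norm x)\<^sup>2"
    by (rule sum_le_norm_ell2)
  finally show ?thesis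
    by (rule power2_le_imp_le) simp
qed

instance ell2 :: complete_space
proof
  fix X :: "nat \<Rightarrow> ell2"
  assume X: "Cauchy X"
  have "Cauchy (\<lambda>n. Rep_ell2 (X n) k)" for k
  proof (rule metric_CauchyI)
    fix e :: real
    assume "0 < e"
    with X obtain M where "\<And>m n. m \<ge> M \<Longrightarrow> n \<ge> M \<Longrightarrow> norm (X m - X n) < e"
      unfolding Cauchy_def dist_norm by blast
    moreover have "cmod (Rep_ell2 (X m) k - Rep_ell2 (X n) k) \<le> norm (X m - X n)" for m n
      using cmod_le_norm_ell2[of "X m - X n" k] by (simp add: Rep_ell2_diff)
    ultimately show "\<exists>M. \<forall>m\<ge>M. \<forall>n\<ge>M. dist (Rep_ell2 (X m) k) (Rep_ell2 (X n) k) < e"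
      unfolding dist_norm by (meson le_less_trans)
  qed
  then have "\<forall>k. \<exists>l. (\<lambda>n. Rep_ell2 (X n) k) \<longlonglongrightarrow> l"
    by (simp add: Cauchy_convergent_iff convergent_def)
  then obtain l where l: "\<And>k. (\<lambda>n. Rep_ell2 (X n) k) \<longlonglongrightarrow> l k"
    by metis
  have bound: "\<exists>M. \<forall>n\<ge>M. \<forall>N. (\<Sum>k<N. (cmod (Rep_ell2 (X n) k - l k))\<^sup>2) \<le> e\<^sup>2"
    if "0 < e" for e
  proof -
    from X that obtain M where M: "\<And>m n. m \<ge> M \<Longrightarrow> n \<ge> M \<Longrightarrow> norm (X m - X n) < e"
      unfolding Cauchy_def dist_norm by blast
    have "(\<Sum>k<N. (cmod (Rep_ell2 (X n) k - l k))\<^sup>2) \<le> e\<^sup>2" if n: "n \<ge> M" for n N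
    proof (rule LIMSEQ_le_const2)
      show "(\<lambda>m. \<Sum>k<N. (cmod (Rep_ell2 (X n) k - Rep_ell2 (X m) k))\<^sup>2)
          \<longlonglongrightarrow> (\<Sum>k<N. (cmod (Rep_ell2 (X n) k - l k))\<^sup>2)"
        by (intro tendsto_intros l)
      have "(\<Sum>k<N. (cmod (Rep_ell2 (X n) k - Rep_ell2 (X m) k))\<^sup>2) \<le> e\<^sup>2" if "m \<ge> M" for m
      proof -
        have "(\<Sum>k<N. (cmod (Rep_ell2 (X n) k - Rep_ell2 (X m) k))\<^sup>2) \<le> (norm (X n - X m))\<^sup>2"
          using sum_le_norm_ell2[of "X n - X m" N] by (simp add: Rep_ell2_diff)
        also have "\<dots> \<le> e\<^sup>2"
          using M[OF n that] by (intro power_mono) auto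
        finally show ?thesis .
      qed
      then show "\<exists>M. \<forall>m\<ge>M. (\<Sum>k<N. (cmod (Rep_ell2 (X n) k - Rep_ell2 (X m) k))\<^sup>2) \<le> e\<^sup>2"
        by blast
    qed
    then show ?thesis
      by blast
  qed
  have summ: "summable (\<lambda>k. (cmod (Rep_ell2 (X n) k - l k))\<^sup>2)"
    if "\<And>N. (\<Sum>k<N. (cmod (Rep_ell2 (X n) k - l k))\<^sup>2) \<le> e" for n e
    using that by (intro summableI_nonneg_bounded) auto
  obtain M where "\<And>N. (\<Sum>k<N. (cmod (Rep_ell2 (X M) k - l k))\<^sup>2) \<le> 1\<^sup>2"
    using bound[of 1] by force
  from ell2_summable_add[OF ell2_summable[of "X M"], of "\<lambda>k. - (Rep_ell2 (X M) k - l k)"]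
    summ[OF this]
  have "summable (\<lambda>k. (cmod (l k))\<^sup>2)"
    by (simp add: norm_minus_commute)
  then have L: "Rep_ell2 (Abs_ell2 l) = l"
    by (simp add: Abs_ell2_inverse)
  have "X \<longlonglongrightarrow> Abs_ell2 l"
  proof (rule metric_LIMSEQ_I)
    fix e :: real
    assume "0 < e"
    then obtain M where M: "\<And>n N. n \<ge> M \<Longrightarrow> (\<Sum>k<N. (cmod (Rep_ell2 (X n) k - l k))\<^sup>2) \<le> (e/2)\<^sup>2"
      using bound[of "e/2"] by auto
    have "dist (X n) (Abs_ell2 l) < e" if "n \<ge> M" for n
    proof -
      have "(norm (X n - Abs_ell2 l))\<^sup>2 \<le> (e/2)\<^sup>2"
        unfolding norm_ell2_eq Rep_ell2_diff L
        by (rule suminf_le_const[OF summ[OF M[OF that]] M[OF that]])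
      then have "norm (X n - Abs_ell2 l) \<le> e/2"
        by (rule power2_le_imp_le) (use \<open>0 < e\<close> in simp)
      then show ?thesis
        using \<open>0 < e\<close> by (simp add: dist_norm)
    qed
    then show "\<exists>M. \<forall>n\<ge>M. dist (X n) (Abs_ell2 l) < e"
      by blast
  qed
  then show "convergent X"
    by (auto simp: convergent_def)
qed

instantiation ell2 :: chilbert_space
begin

lift_definition scaleC_ell2 :: "complex \<Rightarrow> ell2 \<Rightarrow> ell2" is "\<lambda>c f k. c * f k"
  by (rule ell2_summable_scale)

definition cinner_ell2 :: "ell2 \<Rightarrow> ell2 \<Rightarrow> complex" where
  "cinner_ell2 = ell2_cinner"

instance
proof
  fix x y z :: ell2 and c d :: complex and r :: real
  show "c *\<^sub>C (x + y) = c *\<^sub>C x + c *\<^sub>C y" "(c + d) *\<^sub>C x = c *\<^sub>C x + d *\<^sub>C x"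
    "c *\<^sub>C d *\<^sub>C x = (c * d) *\<^sub>C x" "complex_of_real r *\<^sub>C x = r *\<^sub>R x"
    by (transfer; simp add: fun_eq_iff algebra_simps)+
  show "cinner x (c *\<^sub>C y) = c * cinner x y"
    unfolding cinner_ell2_def
  proof transfer
    fix c :: complex and f g :: "nat \<Rightarrow> complex"
    assume "summable (\<lambda>k. (cmod (f k))\<^sup>2)" "summable (\<lambda>k. (cmod (g k))\<^sup>2)"
    then have "summable (\<lambda>k. cnj (f k) * g k)"
      by (rule ell2_summable_mult)
    then show "(\<Sum>k. cnj (f k) * (c * g k)) = c * (\<Sum>k. cnj (f k) * g k)"
      by (simp add: suminf_mult[symmetric] mult.left_commute)
  qed
qed (auto simp: cinner_ell2_def inner_ell2_def ell2_cinner_add_right intro: ell2_cinner_commute)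

end

lift_definition ell2_basis :: "nat \<Rightarrow> ell2" is "\<lambda>j k. if k = j then 1 else 0"
  subgoal for j by (rule summable_finite[of "{j}"]) auto
  done


section \<open>Bounded operators on complex Hilbert spaces\<close>

text \<open>The library type \<open>'h \<Rightarrow>\<^sub>L 'h\<close> consists of the bounded \<^emph>\<open>real\<close>-linear maps with the
  operator norm; \<open>B(H)\<close> is the subset of its complex-linear members.\<close>

definition BH :: "('h::chilbert_space \<Rightarrow>\<^sub>L 'h) set" where
  "BH = {T. \<forall>c x. blinfun_apply T (c *\<^sub>C x) = c *\<^sub>C blinfun_apply T x}"

definition cscale :: "complex \<Rightarrow> ('h::chilbert_space \<Rightarrow>\<^sub>L 'h) \<Rightarrow> ('h \<Rightarrow>\<^sub>L 'h)" where
  "cscale c T = Blinfun (\<lambda>x. c *\<^sub>C blinfun_apply T x)"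

lemma cscale_apply: "blinfun_apply (cscale c T) x = c *\<^sub>C blinfun_apply T x"
proof -
  have "bounded_linear (\<lambda>x. c *\<^sub>C blinfun_apply T x)"
    using bounded_linear_compose[OF bounded_linear_scaleC blinfun.bounded_linear_right] .
  then show ?thesis
    by (simp add: cscale_def bounded_linear_Blinfun_apply)
qed

definition cspan :: "('h::chilbert_space \<Rightarrow>\<^sub>L 'h) set \<Rightarrow> ('h \<Rightarrow>\<^sub>L 'h) set" where
  "cspan S = span {cscale c T | c T. T \<in> S}"

definition matrix_unit :: "nat \<Rightarrow> nat \<Rightarrow> ell2 \<Rightarrow>\<^sub>L ell2" where
  "matrix_unit i j = Blinfun (\<lambda>x. cinner (ell2_basis j) x *\<^sub>C ell2_basis i)"

lemma matrix_unit_apply: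
  "blinfun_apply (matrix_unit i j) x = cinner (ell2_basis j) x *\<^sub>C ell2_basis i"
proof -
  have "bounded_linear (\<lambda>x. cinner (ell2_basis j) x *\<^sub>C ell2_basis i)"
  proof (rule bounded_linear_intro[where K = "norm (ell2_basis j) * norm (ell2_basis i)"])
    fix x :: ell2
    show "norm (cinner (ell2_basis j) x *\<^sub>C ell2_basis i)
        \<le> norm x * (norm (ell2_basis j) * norm (ell2_basis i))"
      using mult_right_mono[OF cinner_bound[of "ell2_basis j" x] norm_ge_zero[of "ell2_basis i"]]
      by (simp add: norm_scaleC algebra_simps)
  next
    fix r and x :: ell2
    show "cinner (ell2_basis j) (r *\<^sub>R x) *\<^sub>C ell2_basis i
        = r *\<^sub>R cinner (ell2_basis j) x *\<^sub>C ell2_basis i"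
      by (simp add: scaleC_of_real[symmetric] cinner_scaleC_right scaleC_scaleC)
  qed (simp add: cinner_add_right scaleC_add_left)
  then show ?thesis
    by (simp add: matrix_unit_def bounded_linear_Blinfun_apply)
qed

text \<open>The norm of an \<open>n \<times> n\<close> matrix over \<open>B(H)\<close>, acting on the \<open>\<ell>\<^sub>2\<close>-sum of \<open>n\<close> copies of \<open>H\<close>.\<close>

definition mat_norm :: "nat \<Rightarrow> (nat \<Rightarrow> nat \<Rightarrow> 'h::chilbert_space \<Rightarrow>\<^sub>L 'h) \<Rightarrow> real" where
  "mat_norm n T =
    Sup {L2_set (\<lambda>i. norm (\<Sum>j<n. blinfun_apply (T i j) (h j))) {..<n} | h.
      L2_set (\<lambda>j. norm (h j)) {..<n} \<le> 1}"

definition scalar_mat_norm :: "'i set \<Rightarrow> ('i \<Rightarrow> 'i \<Rightarrow> complex) \<Rightarrow> real" where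
  "scalar_mat_norm I A =
    Sup {L2_set (\<lambda>i. cmod (\<Sum>j\<in>I. A i j * z j)) I | z. L2_set (\<lambda>j. cmod (z j)) I \<le> 1}"


section \<open>Operator spaces\<close>

definition operator_space :: "('h::chilbert_space \<Rightarrow>\<^sub>L 'h) set \<Rightarrow> bool" where
  "operator_space F \<longleftrightarrow> F \<subseteq> BH \<and> 0 \<in> F \<and> (\<forall>x\<in>F. \<forall>y\<in>F. x + y \<in> F)
    \<and> (\<forall>c. \<forall>x\<in>F. cscale c x \<in> F) \<and> closed F"

definition infinite_dimensional :: "('h::chilbert_space \<Rightarrow>\<^sub>L 'h) set \<Rightarrow> bool" where
  "infinite_dimensional F \<longleftrightarrow> \<not> (\<exists>B. finite B \<and> F \<subseteq> cspan B)"

definition bounded_linear_map ::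
  "('h::chilbert_space \<Rightarrow>\<^sub>L 'h) set \<Rightarrow> (('h \<Rightarrow>\<^sub>L 'h) \<Rightarrow> ('h \<Rightarrow>\<^sub>L 'h)) \<Rightarrow> bool" where
  "bounded_linear_map F u \<longleftrightarrow> (\<forall>x\<in>F. u x \<in> F)
    \<and> (\<forall>x\<in>F. \<forall>y\<in>F. u (x + y) = u x + u y)
    \<and> (\<forall>c. \<forall>x\<in>F. u (cscale c x) = cscale c (u x))
    \<and> (\<exists>K. \<forall>x\<in>F. norm (u x) \<le> K * norm x)"

definition map_norm ::
  "('h::chilbert_space \<Rightarrow>\<^sub>L 'h) set \<Rightarrow> (('h \<Rightarrow>\<^sub>L 'h) \<Rightarrow> ('h \<Rightarrow>\<^sub>L 'h)) \<Rightarrow> real" where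
  "map_norm F u = Sup {norm (u x) | x. x \<in> F \<and> norm x \<le> 1}"

definition matrices_over :: "nat \<Rightarrow> 'a set \<Rightarrow> (nat \<Rightarrow> nat \<Rightarrow> 'a) set" where
  "matrices_over n F = {x. \<forall>i<n. \<forall>j<n. x i j \<in> F}"

definition completely_bounded ::
  "('h::chilbert_space \<Rightarrow>\<^sub>L 'h) set \<Rightarrow> (('h \<Rightarrow>\<^sub>L 'h) \<Rightarrow> ('h \<Rightarrow>\<^sub>L 'h)) \<Rightarrow> bool" where
  "completely_bounded F u \<longleftrightarrow>
    (\<exists>K. \<forall>n. \<forall>x\<in>matrices_over n F. mat_norm n (\<lambda>i j. u (x i j)) \<le> K * mat_norm n x)"

definition cb_norm ::
  "('h::chilbert_space \<Rightarrow>\<^sub>L 'h) set \<Rightarrow> (('h \<Rightarrow>\<^sub>L 'h) \<Rightarrow> ('h \<Rightarrow>\<^sub>L 'h)) \<Rightarrow> real" where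
  "cb_norm F u =
    Sup {mat_norm n (\<lambda>i j. u (x i j)) | n x. x \<in> matrices_over n F \<and> mat_norm n x \<le> 1}"

definition one_homogeneous :: "('h::chilbert_space \<Rightarrow>\<^sub>L 'h) set \<Rightarrow> bool" where
  "one_homogeneous F \<longleftrightarrow>
    (\<forall>u. bounded_linear_map F u \<longrightarrow> completely_bounded F u \<and> cb_norm F u \<le> map_norm F u)"

text \<open>\<open>ip\<close> is a complex inner product on \<open>F\<close> inducing the norm that \<open>F\<close> inherits from \<open>B(H)\<close>.
  Since operator spaces are closed, hence complete, this makes \<open>F\<close> itself a Hilbert space.
  By polarization there is at most one such \<open>ip\<close>.\<close>

definition hilbert_inner ::
  "('h::chilbert_space \<Rightarrow>\<^sub>L 'h) set \<Rightarrow> (('h \<Rightarrow>\<^sub>L 'h) \<Rightarrow> ('h \<Rightarrow>\<^sub>L 'h) \<Rightarrow> complex) \<Rightarrow> bool" where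
  "hilbert_inner F ip \<longleftrightarrow>
    (\<forall>x\<in>F. \<forall>y\<in>F. ip x y = cnj (ip y x))
    \<and> (\<forall>x\<in>F. \<forall>y\<in>F. \<forall>z\<in>F. ip x (y + z) = ip x y + ip x z)
    \<and> (\<forall>c. \<forall>x\<in>F. \<forall>y\<in>F. ip x (cscale c y) = c * ip x y)
    \<and> (\<forall>x\<in>F. ip x x = complex_of_real ((norm x)\<^sup>2))"

definition one_hilbertian :: "('h::chilbert_space \<Rightarrow>\<^sub>L 'h) set \<Rightarrow> bool" where
  "one_hilbertian F \<longleftrightarrow> (\<exists>ip. hilbert_inner F ip)"

definition orthonormal_basis ::
  "('h::chilbert_space \<Rightarrow>\<^sub>L 'h) set \<Rightarrow> (nat \<Rightarrow> 'h \<Rightarrow>\<^sub>L 'h) \<Rightarrow> bool" where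
  "orthonormal_basis F e \<longleftrightarrow> range e \<subseteq> F
    \<and> (\<exists>ip. hilbert_inner F ip \<and> (\<forall>j k. ip (e j) (e k) = (if j = k then 1 else 0)))
    \<and> closure (cspan (range e)) = F"


section \<open>The operator space dual\<close>

definition bounded_functional ::
  "('h::chilbert_space \<Rightarrow>\<^sub>L 'h) set \<Rightarrow> (('h \<Rightarrow>\<^sub>L 'h) \<Rightarrow> complex) \<Rightarrow> bool" where
  "bounded_functional F \<psi> \<longleftrightarrow>
    (\<forall>x\<in>F. \<forall>y\<in>F. \<psi> (x + y) = \<psi> x + \<psi> y)
    \<and> (\<forall>c. \<forall>x\<in>F. \<psi> (cscale c x) = c * \<psi> x)
    \<and> (\<exists>K. \<forall>x\<in>F. cmod (\<psi> x) \<le> K * norm x)"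

text \<open>The cb-norm of \<open>w : F \<rightarrow> M\<^sub>n\<close>, where \<open>M\<^sub>m(M\<^sub>n)\<close> is the algebra of scalar matrices indexed
  by pairs.\<close>

definition cb_norm_into_Mn ::
  "('h::chilbert_space \<Rightarrow>\<^sub>L 'h) set \<Rightarrow> nat \<Rightarrow> (('h \<Rightarrow>\<^sub>L 'h) \<Rightarrow> nat \<Rightarrow> nat \<Rightarrow> complex) \<Rightarrow> real" where
  "cb_norm_into_Mn F n w =
    Sup {scalar_mat_norm ({..<m} \<times> {..<n}) (\<lambda>(k, i) (l, j). w (x k l) i j) | m x.
      x \<in> matrices_over m F \<and> mat_norm m x \<le> 1}"

text \<open>\<open>G\<close> is a concrete realization of \<open>F\<^sup>*\<close>: the pairing \<open>\<phi>\<close> identifies \<open>G\<close> linearly with the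
  space of bounded functionals on \<open>F\<close> in such a way that \<open>M\<^sub>n(G) = CB(F, M\<^sub>n)\<close> isometrically.
  The dual is only determined up to complete isometry, and so are its realizations.\<close>

definition operator_space_dual ::
  "('h::chilbert_space \<Rightarrow>\<^sub>L 'h) set \<Rightarrow> ('k::chilbert_space \<Rightarrow>\<^sub>L 'k) set \<Rightarrow> bool" where
  "operator_space_dual F G \<longleftrightarrow> operator_space G \<and> (\<exists>\<phi>.
      (\<forall>g\<in>G. bounded_functional F (\<phi> g))
    \<and> (\<forall>g\<in>G. \<forall>g'\<in>G. \<forall>x\<in>F. \<phi> (g + g') x = \<phi> g x + \<phi> g' x)
    \<and> (\<forall>c. \<forall>g\<in>G. \<forall>x\<in>F. \<phi> (cscale c g) x = c * \<phi> g x)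
    \<and> (\<forall>\<psi>. bounded_functional F \<psi> \<longrightarrow> (\<exists>!g. g \<in> G \<and> (\<forall>x\<in>F. \<phi> g x = \<psi> x)))
    \<and> (\<forall>n. \<forall>g\<in>matrices_over n G.
        mat_norm n g = cb_norm_into_Mn F n (\<lambda>x i j. \<phi> (g i j) x)))"


section \<open>Minimal tensor products and fundamental functions\<close>

text \<open>The norm of \<open>\<Sum>\<^sub>j\<^sub>\<in>\<^sub>J \<xi>\<^sub>j \<otimes> \<eta>\<^sub>j\<close> in the Hilbert space tensor product.\<close>

definition tensor_norm ::
  "'j set \<Rightarrow> ('j \<Rightarrow> 'h::chilbert_space) \<Rightarrow> ('j \<Rightarrow> 'k::chilbert_space) \<Rightarrow> real" where
  "tensor_norm J \<xi> \<eta> =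
    sqrt (Re (\<Sum>i\<in>J. \<Sum>j\<in>J. cinner (\<xi> i) (\<xi> j) * cinner (\<eta> i) (\<eta> j)))"

text \<open>For operator spaces \<open>E \<subseteq> B(H)\<close>, \<open>F \<subseteq> B(K)\<close> the tensor product \<open>E \<otimes>\<^sub>m\<^sub>i\<^sub>n F\<close> carries the norm
  of \<open>B(H \<otimes> K)\<close>; this is the norm of \<open>\<Sum>\<^sub>k\<^sub>\<in>\<^sub>A a\<^sub>k \<otimes> x\<^sub>k\<close> there, computed on the dense algebraic
  tensor product of \<open>H\<close> and \<open>K\<close>.\<close>

definition min_tensor_norm ::
  "'i set \<Rightarrow> ('i \<Rightarrow> 'h::chilbert_space \<Rightarrow>\<^sub>L 'h) \<Rightarrow> ('i \<Rightarrow> 'k::chilbert_space \<Rightarrow>\<^sub>L 'k) \<Rightarrow> real" where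
  "min_tensor_norm A a x =
    Sup {tensor_norm (A \<times> {..<m}) (\<lambda>(k, j). blinfun_apply (a k) (\<xi> j))
        (\<lambda>(k, j). blinfun_apply (x k) (\<eta> j)) | (m::nat) \<xi> \<eta>. tensor_norm {..<m} \<xi> \<eta> \<le> 1}"

definition column_space :: "(ell2 \<Rightarrow>\<^sub>L ell2) set" where
  "column_space = closure (cspan (range (\<lambda>k. matrix_unit k 0)))"

definition row_space :: "(ell2 \<Rightarrow>\<^sub>L ell2) set" where
  "row_space = closure (cspan (range (\<lambda>k. matrix_unit 0 k)))"

text \<open>Indices start at \<open>0\<close>. The spaces \<^const>\<open>column_space\<close>, \<^const>\<open>row_space\<close> and \<open>F\<close> enter only
  through their embeddings, as the minimal tensor norm is that of the ambient \<open>B(\<ell>\<^sub>2 \<otimes> H)\<close>.\<close>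

definition Phi_c :: "(nat \<Rightarrow> 'h::chilbert_space \<Rightarrow>\<^sub>L 'h) \<Rightarrow> nat \<Rightarrow> real" where
  "Phi_c e n = (min_tensor_norm {..<n} (\<lambda>k. matrix_unit k 0) e)\<^sup>2"

definition Phi_r :: "(nat \<Rightarrow> 'h::chilbert_space \<Rightarrow>\<^sub>L 'h) \<Rightarrow> nat \<Rightarrow> real" where
  "Phi_r e n = (min_tensor_norm {..<n} (\<lambda>k. matrix_unit 0 k) e)\<^sup>2"

end

theory Submission
  imports Defs
begin

text \<open>
The fundamental functions \<open>\<Phi>\<^sub>c\<close> and \<open>\<Phi>\<^sub>r\<close> are squares of matrix norms: tensoring with the first column of matrix
units turns \<open>e\<^sub>0, \<dots>, e\<^sub>n\<^sub>-\<^sub>1\<close> into a column over \<open>F\<close>, tensoring with the first row turns it into a row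
(\<open>Phi_c_eq_column_norm\<close>, \<open>Phi_r_eq_row_norm\<close>). An orthonormal basis of \<open>F\<^sup>*\<close> consists, by Riesz
representation, of the functionals \<open>\<langle>v\<^sub>k, \<cdot>\<rangle>\<close> for some orthonormal sequence \<open>v\<close> in \<open>F\<close>
(\<open>dual_basis\<close>), and since \<open>M\<^sub>n(F\<^sup>*) = CB(F, M\<^sub>n)\<close>, the column norm of the dual basis is the cb-norm of
the map \<open>w\<close> that sends \<open>x\<close> to the column of its coordinates \<open>\<langle>v\<^sub>k, x\<rangle>\<close>. So the claim for columns
is that this cb-norm times the column norm \<open>P\<close> of \<open>e\<^sub>0, \<dots>, e\<^sub>n\<^sub>-\<^sub>1\<close> is \<open>\<surd>n\<close> (\<open>dual_column_norm\<close>), and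
similarly for rows (\<open>dual_row_norm\<close>).

The lower bound comes from one test element: applied entrywise to the column of the \<open>v\<^sub>k\<close>, the map
\<open>w\<close> produces a single column with \<open>n\<close> ones, of norm \<open>\<surd>n\<close>. The column norm of the \<open>v\<^sub>k\<close> is at most
that of the \<open>e\<^sub>k\<close>, because \<open>x \<mapsto> \<Sum>\<^sub>k \<langle>e\<^sub>k, x\<rangle> v\<^sub>k\<close> is a contraction and hence, by homogeneity, a complete
contraction (\<open>change_of_basis\<close>).

The upper bound is an averaging argument. By homogeneity, all the maps
\<open>u\<^sub>r\<^sub>,\<^sub>t x = \<Sum>\<^sub>k \<omega>\<^sup>k\<^sup>r \<langle>v\<^sub>k, x\<rangle> e\<^sub>k\<^sub>+\<^sub>t\<close> with \<open>\<omega> = exp (2\<pi>i/n)\<close> and indices modulo \<open>n\<close> are complete contractions.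
Let \<open>x\<close> be a matrix over \<open>F\<close> and let \<open>a\<^sub>k\<close> be the scalar matrix of its \<open>k\<close>-th coordinates. Then
\<open>\<Sum>\<^sub>k \<omega>\<^sup>k\<^sup>r a\<^sub>k \<otimes> e\<^sub>k\<^sub>+\<^sub>t\<close> has norm at most that of \<open>x\<close>. Evaluated at an elementary tensor \<open>z \<otimes> h\<close>, the sum of the
squared norms over \<open>r\<close> removes the cross terms (Parseval's identity for the discrete Fourier
transform) and the sum over \<open>t\<close> decouples the two factors, which leaves
\<open>(\<Sum>\<^sub>k \<parallel>a\<^sub>k z\<parallel>\<^sup>2) (\<Sum>\<^sub>j \<parallel>e\<^sub>j h\<parallel>\<^sup>2) \<le> n \<parallel>x\<parallel>\<^sup>2 \<parallel>z\<parallel>\<^sup>2 \<parallel>h\<parallel>\<^sup>2\<close> (\<open>column_twirl_le\<close>). The supremum over \<open>z\<close> and \<open>h\<close> is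
the bound \<open>\<parallel>w\<parallel>\<^sub>c\<^sub>b P \<le> \<surd>n\<close>. For rows the test vectors have to be averaged along with the operators,
see \<open>row_twirl_le\<close>.
\<close>

section \<open>Sums and scalars in complex Hilbert spaces\<close>

lemma scaleC_zero_right [simp]: "c *\<^sub>C (0::'h::chilbert_space) = 0"
  using norm_scaleC[of c "0::'h"] by simp

lemma scaleC_zero_left [simp]: "0 *\<^sub>C (x::'h::chilbert_space) = 0"
  using norm_scaleC[of 0 x] by simp

lemma scaleC_one [simp]: "1 *\<^sub>C (x::'h::chilbert_space) = x"
  using scaleC_of_real[of 1 x] by simp

lemma scaleC_sum_right: "c *\<^sub>C sum f A = (\<Sum>a\<in>A. c *\<^sub>C (f a :: 'h::chilbert_space))"
  by (induction A rule: infinite_finite_induct) (simp_all add: scaleC_add_right)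

lemma scaleC_sum_left: "sum f A *\<^sub>C (x::'h::chilbert_space) = (\<Sum>a\<in>A. f a *\<^sub>C x)"
  by (induction A rule: infinite_finite_induct) (simp_all add: scaleC_add_left)

lemma cinner_zero_right [simp]: "cinner x (0::'h::chilbert_space) = 0"
  using cinner_bound[of x 0] by simp

lemma cinner_sum_right: "cinner x (sum f A) = (\<Sum>a\<in>A. cinner x (f a :: 'h::chilbert_space))"
  by (induction A rule: infinite_finite_induct) (simp_all add: cinner_add_right)

lemma cinner_sum_left: "cinner (sum f A) x = (\<Sum>a\<in>A. cinner (f a :: 'h::chilbert_space) x)"
  by (simp add: cinner_commute[of _ x] cinner_sum_right)

lemma norm_sum_scaleC:
  fixes y :: "'i \<Rightarrow> 'h::chilbert_space"
  shows "complex_of_real ((norm (\<Sum>k\<in>A. c k *\<^sub>C y k))\<^sup>2)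
    = (\<Sum>k\<in>A. \<Sum>l\<in>A. cnj (c k) * c l * cinner (y k) (y l))"
  unfolding cinner_self[symmetric] cinner_sum_left cinner_sum_right
  by (subst sum.swap) (simp add: cinner_scaleC_left cinner_scaleC_right mult_ac)

lemma cscale_add_right: "cscale c (S + T) = cscale c S + cscale c T"
  by (rule blinfun_eqI) (simp add: cscale_apply blinfun.add_left scaleC_add_right)

lemma cscale_add_left: "cscale (c + d) T = cscale c T + cscale d T"
  by (rule blinfun_eqI) (simp add: cscale_apply blinfun.add_left scaleC_add_left)

lemma cscale_cscale: "cscale c (cscale d T) = cscale (c * d) T"
  by (rule blinfun_eqI) (simp add: cscale_apply scaleC_scaleC)

lemma cscale_of_real: "cscale (complex_of_real r) T = r *\<^sub>R T"
  by (rule blinfun_eqI) (simp add: cscale_apply blinfun.scaleR_left scaleC_of_real)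

lemma cscale_zero_left [simp]: "cscale 0 T = 0"
  by (rule blinfun_eqI) (simp add: cscale_apply)

lemma cscale_zero_right [simp]: "cscale c 0 = 0"
  by (rule blinfun_eqI) (simp add: cscale_apply)

lemma cscale_one [simp]: "cscale 1 T = T"
  by (rule blinfun_eqI) (simp add: cscale_apply)

lemma cscale_sum_right: "cscale c (sum f A) = (\<Sum>a\<in>A. cscale c (f a))"
  by (induction A rule: infinite_finite_induct) (simp_all add: cscale_add_right)

text \<open>This makes the bounded operators a Banach space, in which the series for Riesz vectors converge.\<close>

instance chilbert_space \<subseteq> banach ..

section \<open>Norms of matrices as best constants\<close>

text \<open>Each of the matrix and map norms is a supremum of some \<open>T v\<close> over all \<open>v\<close> with \<open>N v \<le> 1\<close>. When \<open>T\<close> and \<open>N\<close>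
are positively homogeneous, such a supremum is the least \<open>K\<close> with \<open>T v \<le> K * N v\<close> for all \<open>v\<close>. An
a priori constant \<open>B\<close> is required, as the supremum of an unbounded set of reals is unspecified. The
rescaling is a parameter, so that \<open>v\<close> may range over matrices of varying size.\<close>

lemma homogeneous_sup:
  fixes N T :: "'v \<Rightarrow> real" and scl :: "real \<Rightarrow> 'v \<Rightarrow> 'v" and V :: "'v set"
  defines "M \<equiv> Sup {T v | v. v \<in> V \<and> N v \<le> 1}"
  assumes "v0 \<in> V"
    and scl: "\<And>r v. v \<in> V \<Longrightarrow> r \<ge> 0 \<Longrightarrow> scl r v \<in> V"
    and N: "\<And>r v. v \<in> V \<Longrightarrow> r \<ge> 0 \<Longrightarrow> N (scl r v) = r * N v"
    and T: "\<And>r v. v \<in> V \<Longrightarrow> r \<ge> 0 \<Longrightarrow> T (scl r v) = r * T v"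
    and pos: "\<And>v. v \<in> V \<Longrightarrow> 0 \<le> N v"
    and bound: "\<And>v. v \<in> V \<Longrightarrow> T v \<le> B * N v"
  shows homogeneous_sup_nonneg: "0 \<le> M"
    and homogeneous_sup_bound: "\<And>v. v \<in> V \<Longrightarrow> T v \<le> M * N v"
    and homogeneous_sup_least: "\<And>K. 0 \<le> K \<Longrightarrow> (\<And>v. v \<in> V \<Longrightarrow> T v \<le> K * N v) \<Longrightarrow> M \<le> K"
proof -
  have mem: "0 \<in> {T v | v. v \<in> V \<and> N v \<le> 1}"
    using scl[OF \<open>v0 \<in> V\<close>, of 0] N[OF \<open>v0 \<in> V\<close>, of 0] T[OF \<open>v0 \<in> V\<close>, of 0] by force
  have bdd: "bdd_above {T v | v. v \<in> V \<and> N v \<le> 1}"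
  proof (rule bdd_aboveI)
    fix t
    assume "t \<in> {T v | v. v \<in> V \<and> N v \<le> 1}"
    then obtain v where v: "v \<in> V" "N v \<le> 1" "t = T v"
      by blast
    have "t \<le> \<bar>B\<bar> * N v"
      using bound[OF v(1)] mult_right_mono[OF abs_ge_self pos[OF v(1)], of B] v(3) by linarith
    also have "\<dots> \<le> \<bar>B\<bar> * 1"
      using v(2) by (intro mult_left_mono) auto
    finally show "t \<le> \<bar>B\<bar>" by simp
  qed
  show "0 \<le> M"
    unfolding M_def using mem bdd by (rule cSup_upper)
  show "T v \<le> M * N v" if v: "v \<in> V" for v
  proof (cases "N v = 0")
    case True
    then show ?thesis
      using bound[OF v] by simp
  next
    case False
    then have p: "0 < N v"
      using pos[OF v] by simp
    define r where "r = 1 / N v"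
    have "r \<ge> 0" "r * N v = 1"
      using p by (auto simp: r_def)
    then have "T (scl r v) \<in> {T v | v. v \<in> V \<and> N v \<le> 1}"
      using scl[OF v] N[OF v] by force
    then have "T (scl r v) \<le> M"
      unfolding M_def using bdd by (rule cSup_upper)
    then show ?thesis
      using T[OF v \<open>r \<ge> 0\<close>] p by (simp add: r_def pos_divide_le_eq)
  qed
  show "M \<le> K" if "0 \<le> K" "\<And>v. v \<in> V \<Longrightarrow> T v \<le> K * N v" for K
    unfolding M_def
  proof (rule cSup_least)
    show "{T v | v. v \<in> V \<and> N v \<le> 1} \<noteq> {}"
      using mem by blast
    fix t
    assume "t \<in> {T v | v. v \<in> V \<and> N v \<le> 1}"
    then obtain v where v: "v \<in> V" "N v \<le> 1" "t = T v"
      by blast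
    then show "t \<le> K"
      using that(2)[OF v(1)] mult_left_mono[OF v(2) \<open>0 \<le> K\<close>] by simp
  qed
qed

lemma L2_set_power2: "(L2_set f A)\<^sup>2 = (\<Sum>a\<in>A. (f a)\<^sup>2)"
  by (simp add: L2_set_def sum_nonneg)

text \<open>Estimates of operator norms are kept in squared form, where they become inequalities between
finite sums.\<close>

lemma L2_set_le_iff:
  assumes "0 \<le> K"
  shows "L2_set f A \<le> K * L2_set g B \<longleftrightarrow> (\<Sum>a\<in>A. (f a)\<^sup>2) \<le> K\<^sup>2 * (\<Sum>b\<in>B. (g b)\<^sup>2)"
  unfolding L2_set_power2[symmetric] power_mult_distrib[symmetric]
  using assms by (simp add: abs_le_square_iff[symmetric] abs_mult)

lemma mat_norm_sup:
  fixes T :: "nat \<Rightarrow> nat \<Rightarrow> 'h::chilbert_space \<Rightarrow>\<^sub>L 'h"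
  shows mat_norm_nonneg: "0 \<le> mat_norm n T"
    and mat_norm_bound: "(\<Sum>i<n. (norm (\<Sum>j<n. blinfun_apply (T i j) (h j)))\<^sup>2)
      \<le> (mat_norm n T)\<^sup>2 * (\<Sum>j<n. (norm (h j))\<^sup>2)"
    and mat_norm_least: "0 \<le> K \<Longrightarrow> (\<And>h. (\<Sum>i<n. (norm (\<Sum>j<n. blinfun_apply (T i j) (h j)))\<^sup>2)
      \<le> K\<^sup>2 * (\<Sum>j<n. (norm (h j))\<^sup>2)) \<Longrightarrow> mat_norm n T \<le> K"
proof -
  define N where "N = (\<lambda>h::nat \<Rightarrow> 'h. L2_set (\<lambda>j. norm (h j)) {..<n})"
  define P where "P = (\<lambda>h. L2_set (\<lambda>i. norm (\<Sum>j<n. blinfun_apply (T i j) (h j))) {..<n})"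
  define s where "s = (\<lambda>r (h::nat \<Rightarrow> 'h) j. r *\<^sub>R h j)"
  have M: "mat_norm n T = Sup {P v | v. v \<in> UNIV \<and> N v \<le> 1}"
    by (simp add: mat_norm_def P_def N_def)
  have N: "N (s r h) = r * N h" if "r \<ge> 0" for r h
    using that by (simp add: N_def s_def L2_set_right_distrib)
  have P: "P (s r h) = r * P h" if "r \<ge> 0" for r h
    using that
    by (simp add: P_def s_def L2_set_right_distrib blinfun.scaleR_right flip: scaleR_sum_right)
  have B: "P h \<le> (\<Sum>i<n. \<Sum>j<n. norm (T i j)) * N h" for h
  proof -
    have "P h \<le> (\<Sum>i<n. norm (\<Sum>j<n. blinfun_apply (T i j) (h j)))"
      unfolding P_def by (rule L2_set_le_sum) simp
    also have "\<dots> \<le> (\<Sum>i<n. \<Sum>j<n. norm (T i j) * N h)"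
      unfolding N_def
      by (intro sum_mono sum_norm_le)
        (auto intro!: order.trans[OF norm_blinfun] mult_left_mono
          member_le_L2_set[where f = "\<lambda>j. norm (h j)"])
    finally show ?thesis
      by (simp add: sum_distrib_right)
  qed
  have pos: "0 \<le> N h" for h
    by (simp add: N_def L2_set_nonneg)
  note sup = homogeneous_sup[of undefined UNIV s N P, OF _ _ N P pos B, folded M, simplified]
  show p: "0 \<le> mat_norm n T"
    by (rule sup(1))
  have "P h \<le> mat_norm n T * N h"
    by (rule sup(2))
  then show "(\<Sum>i<n. (norm (\<Sum>j<n. blinfun_apply (T i j) (h j)))\<^sup>2)
      \<le> (mat_norm n T)\<^sup>2 * (\<Sum>j<n. (norm (h j))\<^sup>2)"
    unfolding P_def N_def L2_set_le_iff[OF p] .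
  show "mat_norm n T \<le> K" if "0 \<le> K" "\<And>h. (\<Sum>i<n. (norm (\<Sum>j<n. blinfun_apply (T i j) (h j)))\<^sup>2)
      \<le> K\<^sup>2 * (\<Sum>j<n. (norm (h j))\<^sup>2)"
    using that(1)
    by (rule sup(3)) (use that in \<open>simp add: P_def N_def L2_set_le_iff\<close>)
qed

lemma scalar_mat_norm_sup:
  fixes A :: "'i \<Rightarrow> 'i \<Rightarrow> complex"
  assumes "finite I"
  shows scalar_mat_norm_nonneg: "0 \<le> scalar_mat_norm I A"
    and scalar_mat_norm_bound: "(\<Sum>i\<in>I. (cmod (\<Sum>j\<in>I. A i j * z j))\<^sup>2)
      \<le> (scalar_mat_norm I A)\<^sup>2 * (\<Sum>j\<in>I. (cmod (z j))\<^sup>2)"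
    and scalar_mat_norm_least: "0 \<le> K \<Longrightarrow> (\<And>z. (\<Sum>i\<in>I. (cmod (\<Sum>j\<in>I. A i j * z j))\<^sup>2)
      \<le> K\<^sup>2 * (\<Sum>j\<in>I. (cmod (z j))\<^sup>2)) \<Longrightarrow> scalar_mat_norm I A \<le> K"
proof -
  define N where "N = (\<lambda>z. L2_set (\<lambda>j. cmod (z j)) I)"
  define P where "P = (\<lambda>z. L2_set (\<lambda>i. cmod (\<Sum>j\<in>I. A i j * z j)) I)"
  define s where "s = (\<lambda>r (z::'i \<Rightarrow> complex) j. complex_of_real r * z j)"
  have M: "scalar_mat_norm I A = Sup {P v | v. v \<in> UNIV \<and> N v \<le> 1}"
    by (simp add: scalar_mat_norm_def P_def N_def)
  have N: "N (s r h) = r * N h" if "r \<ge> 0" for r h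
    using that by (simp add: N_def s_def L2_set_right_distrib norm_mult)
  have P: "P (s r h) = r * P h" if "r \<ge> 0" for r h
    using that
    by (simp add: P_def s_def L2_set_right_distrib mult.left_commute norm_mult
        flip: sum_distrib_left)
  have B: "P h \<le> (\<Sum>i\<in>I. \<Sum>j\<in>I. cmod (A i j)) * N h" for h
  proof -
    have "P h \<le> (\<Sum>i\<in>I. norm (\<Sum>j\<in>I. A i j * h j))"
      unfolding P_def by (rule L2_set_le_sum) simp
    also have "\<dots> \<le> (\<Sum>i\<in>I. \<Sum>j\<in>I. cmod (A i j) * N h)"
      unfolding N_def
      by (intro sum_mono sum_norm_le)
        (auto intro!: mult_left_mono \<open>finite I\<close>
          member_le_L2_set[where f = "\<lambda>j. cmod (h j)"] simp: norm_mult)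
    finally show ?thesis
      by (simp add: sum_distrib_right)
  qed
  have pos: "0 \<le> N h" for h
    by (simp add: N_def L2_set_nonneg)
  note sup = homogeneous_sup[of undefined UNIV s N P, OF _ _ N P pos B, folded M, simplified]
  show p: "0 \<le> scalar_mat_norm I A"
    by (rule sup(1))
  have "P z \<le> scalar_mat_norm I A * N z"
    by (rule sup(2))
  then show "(\<Sum>i\<in>I. (cmod (\<Sum>j\<in>I. A i j * z j))\<^sup>2)
      \<le> (scalar_mat_norm I A)\<^sup>2 * (\<Sum>j\<in>I. (cmod (z j))\<^sup>2)"
    unfolding P_def N_def L2_set_le_iff[OF p] .
  show "scalar_mat_norm I A \<le> K" if "0 \<le> K" "\<And>z. (\<Sum>i\<in>I. (cmod (\<Sum>j\<in>I. A i j * z j))\<^sup>2)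
      \<le> K\<^sup>2 * (\<Sum>j\<in>I. (cmod (z j))\<^sup>2)"
    using that(1)
    by (rule sup(3)) (use that in \<open>simp add: P_def N_def L2_set_le_iff\<close>)
qed

lemma mat_norm_scaleR:
  fixes T :: "nat \<Rightarrow> nat \<Rightarrow> 'h::chilbert_space \<Rightarrow>\<^sub>L 'h"
  assumes "0 \<le> r"
  shows "mat_norm n (\<lambda>i j. r *\<^sub>R T i j) = r * mat_norm n T"
proof -
  have le: "mat_norm n (\<lambda>i j. r *\<^sub>R T i j) \<le> r * mat_norm n T"
    if "0 \<le> r" for r and T :: "nat \<Rightarrow> nat \<Rightarrow> 'h \<Rightarrow>\<^sub>L 'h"
  proof (rule mat_norm_least)
    fix h :: "nat \<Rightarrow> 'h"
    show "(\<Sum>i<n. (norm (\<Sum>j<n. blinfun_apply (r *\<^sub>R T i j) (h j)))\<^sup>2)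
      \<le> (r * mat_norm n T)\<^sup>2 * (\<Sum>j<n. (norm (h j))\<^sup>2)"
      using mult_left_mono[OF mat_norm_bound[where T = T and h = h], of "r\<^sup>2"]
      by (simp add: blinfun.scaleR_left power_mult_distrib mult.assoc
          flip: scaleR_sum_right sum_distrib_left)
  qed (simp add: that mat_norm_nonneg)
  show ?thesis
  proof (cases "r = 0")
    case True
    then show ?thesis
      using le[of 0 T] mat_norm_nonneg[of n "\<lambda>i j. 0 *\<^sub>R T i j"] by simp
  next
    case False
    then show ?thesis
      using le[OF assms, of T] le[of "1/r" "\<lambda>i j. r *\<^sub>R T i j"] assms
      by (simp add: field_simps)
  qed
qed

lemma scalar_mat_norm_scale:
  assumes "0 \<le> r" and I: "finite I"
  shows "scalar_mat_norm I (\<lambda>i j. complex_of_real r * A i j) = r * scalar_mat_norm I A"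
proof -
  have le: "scalar_mat_norm I (\<lambda>i j. complex_of_real r * A i j) \<le> r * scalar_mat_norm I A"
    if "0 \<le> r" for r A
  proof (rule scalar_mat_norm_least[OF I])
    fix z
    show "(\<Sum>i\<in>I. (cmod (\<Sum>j\<in>I. complex_of_real r * A i j * z j))\<^sup>2)
      \<le> (r * scalar_mat_norm I A)\<^sup>2 * (\<Sum>j\<in>I. (cmod (z j))\<^sup>2)"
      using mult_left_mono[OF scalar_mat_norm_bound[where A = A and z = z, OF I], of "r\<^sup>2"]
      by (simp add: power_mult_distrib norm_mult mult.assoc flip: sum_distrib_left)
  qed (simp add: that scalar_mat_norm_nonneg[OF I])
  show ?thesis
  proof (cases "r = 0")
    case True
    then show ?thesis
      using le[of 0 A] scalar_mat_norm_nonneg[OF I, of "\<lambda>i j. 0"] by simp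
  next
    case False
    then have "(\<lambda>i j. complex_of_real (1/r) * (complex_of_real r * A i j)) = A"
      by (auto simp: fun_eq_iff)
    then have "scalar_mat_norm I A \<le> 1/r * scalar_mat_norm I (\<lambda>i j. complex_of_real r * A i j)"
      using le[of "1/r" "\<lambda>i j. complex_of_real r * A i j"] assms by simp
    then show ?thesis
      using le[OF assms(1), of A] False assms by (simp add: field_simps)
  qed
qed

section \<open>The fundamental functions as column and row norms\<close>

text \<open>A sequence becomes a square matrix that is zero outside its first column or row, since
\<^const>\<open>mat_norm\<close> and \<^const>\<open>operator_space_dual\<close> are formulated for square matrices.\<close>

definition column_matrix :: "(nat \<Rightarrow> 'a::zero) \<Rightarrow> nat \<Rightarrow> nat \<Rightarrow> 'a" where
  "column_matrix y i j = (if j = 0 then y i else 0)"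

definition row_matrix :: "(nat \<Rightarrow> 'a::zero) \<Rightarrow> nat \<Rightarrow> nat \<Rightarrow> 'a" where
  "row_matrix y i j = (if i = 0 then y j else 0)"

lemma column_matrix_apply:
  "0 < n \<Longrightarrow> (\<Sum>j<n. blinfun_apply (column_matrix y i j) (h j)) = blinfun_apply (y i) (h 0)"
  by (simp add: column_matrix_def if_distrib if_distribR cong: if_cong)

lemma row_matrix_apply:
  "(\<Sum>j<n. blinfun_apply (row_matrix y i j) (h j))
    = (if i = 0 then \<Sum>j<n. blinfun_apply (y j) (h j) else 0)"
  by (simp add: row_matrix_def)

lemma ell2_cinner_sums: "(\<lambda>p. cnj (Rep_ell2 x p) * Rep_ell2 y p) sums cinner x y"
  unfolding cinner_ell2_def ell2_cinner.rep_eq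
  by (intro summable_sums ell2_summable_mult ell2_summable)

text \<open>Expanding the first factor in the standard basis of \<open>\<ell>\<^sub>2\<close> identifies the tensor product with an
\<open>\<ell>\<^sub>2\<close>-sum of copies of the second space. In particular each coordinate map is a contraction,
independently of how the tensor is written.\<close>

lemma
  fixes \<eta> :: "'j \<Rightarrow> 'h::chilbert_space"
  assumes "finite J"
  shows tensor_norm_sums:
      "(\<lambda>p. (norm (\<Sum>j\<in>J. Rep_ell2 (\<xi> j) p *\<^sub>C \<eta> j))\<^sup>2) sums (tensor_norm J \<xi> \<eta>)\<^sup>2"
    and tensor_norm_nonneg: "0 \<le> tensor_norm J \<xi> \<eta>"
proof -
  define S where "S = (\<Sum>i\<in>J. \<Sum>j\<in>J. cinner (\<xi> i) (\<xi> j) * cinner (\<eta> i) (\<eta> j))"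
  have "(\<lambda>p. complex_of_real ((norm (\<Sum>j\<in>J. Rep_ell2 (\<xi> j) p *\<^sub>C \<eta> j))\<^sup>2)) sums S"
    unfolding S_def norm_sum_scaleC by (intro sums_sum sums_mult2 ell2_cinner_sums)
  then have *: "(\<lambda>p. (norm (\<Sum>j\<in>J. Rep_ell2 (\<xi> j) p *\<^sub>C \<eta> j))\<^sup>2) sums Re S"
    using sums_Re by fastforce
  have "0 \<le> Re S"
    using sums_le[OF _ sums_zero *] by simp
  with * show "(\<lambda>p. (norm (\<Sum>j\<in>J. Rep_ell2 (\<xi> j) p *\<^sub>C \<eta> j))\<^sup>2) sums (tensor_norm J \<xi> \<eta>)\<^sup>2"
    and "0 \<le> tensor_norm J \<xi> \<eta>"
    by (simp_all add: tensor_norm_def S_def)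
qed

lemma cinner_ell2_basis: "cinner (ell2_basis j) x = Rep_ell2 x j"
proof (rule sums_unique2)
  show "(\<lambda>p. cnj (Rep_ell2 (ell2_basis j) p) * Rep_ell2 x p) sums cinner (ell2_basis j) x"
    by (rule ell2_cinner_sums)
  show "(\<lambda>p. cnj (Rep_ell2 (ell2_basis j) p) * Rep_ell2 x p) sums Rep_ell2 x j"
    using sums_single[of j "Rep_ell2 x"] by (simp add: ell2_basis.rep_eq if_distrib if_distribR cong: if_cong)
qed

lemma Rep_matrix_unit:
  "Rep_ell2 (blinfun_apply (matrix_unit i j) x) p = (if p = i then Rep_ell2 x j else 0)"
  by (simp add: matrix_unit_apply cinner_ell2_basis scaleC_ell2.rep_eq ell2_basis.rep_eq)

lemma BH_scaleC_sum:
  "T \<in> BH \<Longrightarrow> (\<Sum>j\<in>A. c j *\<^sub>C blinfun_apply T (y j)) = blinfun_apply T (\<Sum>j\<in>A. c j *\<^sub>C y j)"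
  by (simp add: BH_def blinfun.sum_right)

text \<open>A first-column matrix unit only sees the coordinate with index \<open>0\<close> of the vectors in \<open>\<ell>\<^sub>2\<close>, so the
tensor acts through the single vector \<open>\<Sum>\<^sub>j \<xi>\<^sub>j(0) \<eta>\<^sub>j\<close>, and the images \<open>e\<^sub>k\<close> of it are placed in orthogonal
coordinates.\<close>

lemma column_tensor_norm:
  fixes e :: "nat \<Rightarrow> 'h::chilbert_space \<Rightarrow>\<^sub>L 'h" and m :: nat
  assumes e: "e ` {..<n} \<subseteq> BH"
  shows "tensor_norm ({..<n} \<times> {..<m}) (\<lambda>(k, j). blinfun_apply (matrix_unit k 0) (\<xi> j))
      (\<lambda>(k, j). blinfun_apply (e k) (\<eta> j))
    = L2_set (\<lambda>k. norm (blinfun_apply (e k) (\<Sum>j<m. Rep_ell2 (\<xi> j) 0 *\<^sub>C \<eta> j))) {..<n}"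
    (is "?t = L2_set (\<lambda>k. norm (blinfun_apply (e k) ?h)) _")
proof (rule power2_eq_imp_eq)
  have "(\<Sum>q\<in>{..<n} \<times> {..<m}. Rep_ell2 ((\<lambda>(k, j). blinfun_apply (matrix_unit k 0) (\<xi> j)) q) p
        *\<^sub>C (\<lambda>(k, j). blinfun_apply (e k) (\<eta> j)) q)
      = (if p < n then blinfun_apply (e p) ?h else 0)" (is "?l = _") for p
  proof -
    have "?l = (\<Sum>k<n. \<Sum>j<m. (if p = k then Rep_ell2 (\<xi> j) 0 else 0) *\<^sub>C blinfun_apply (e k) (\<eta> j))"
      by (simp add: sum.cartesian_product Rep_matrix_unit case_prod_unfold)
    also have "\<dots> = (\<Sum>k<n. if p = k then blinfun_apply (e k) ?h else 0)"
      using e by (intro sum.cong) (auto simp: BH_scaleC_sum image_subset_iff)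
    finally show ?thesis
      by simp
  qed
  then have "(\<lambda>p. (norm (if p < n then blinfun_apply (e p) ?h else 0))\<^sup>2) sums ?t\<^sup>2"
    using tensor_norm_sums[of "{..<n} \<times> {..<m}" "\<lambda>(k, j). blinfun_apply (matrix_unit k 0) (\<xi> j)"
        "\<lambda>(k, j). blinfun_apply (e k) (\<eta> j)"] by simp
  moreover have "(\<lambda>p. (norm (if p < n then blinfun_apply (e p) ?h else 0))\<^sup>2)
      sums (\<Sum>p<n. (norm (if p < n then blinfun_apply (e p) ?h else 0))\<^sup>2)"
    by (rule sums_finite) auto
  ultimately show "?t\<^sup>2 = (L2_set (\<lambda>k. norm (blinfun_apply (e k) ?h)) {..<n})\<^sup>2"
    by (simp add: L2_set_power2 sums_unique2)
  show "0 \<le> ?t"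
    by (simp add: tensor_norm_nonneg)
qed (simp add: L2_set_nonneg)

text \<open>Here the \<open>k\<close>-th operator acts on the \<open>k\<close>-th coordinate vector, and all the images are added up in
the coordinate with index \<open>0\<close>.\<close>

lemma row_tensor_norm:
  fixes e :: "nat \<Rightarrow> 'h::chilbert_space \<Rightarrow>\<^sub>L 'h" and m :: nat
  assumes e: "e ` {..<n} \<subseteq> BH"
  shows "tensor_norm ({..<n} \<times> {..<m}) (\<lambda>(k, j). blinfun_apply (matrix_unit 0 k) (\<xi> j))
      (\<lambda>(k, j). blinfun_apply (e k) (\<eta> j))
    = norm (\<Sum>k<n. blinfun_apply (e k) (\<Sum>j<m. Rep_ell2 (\<xi> j) k *\<^sub>C \<eta> j))"
    (is "?t = norm ?g")
proof (rule power2_eq_imp_eq)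
  have "(\<Sum>q\<in>{..<n} \<times> {..<m}. Rep_ell2 ((\<lambda>(k, j). blinfun_apply (matrix_unit 0 k) (\<xi> j)) q) p
        *\<^sub>C (\<lambda>(k, j). blinfun_apply (e k) (\<eta> j)) q)
      = (if p = 0 then ?g else 0)" (is "?l = _") for p
  proof -
    have "?l = (\<Sum>k<n. \<Sum>j<m. (if p = 0 then Rep_ell2 (\<xi> j) k else 0) *\<^sub>C blinfun_apply (e k) (\<eta> j))"
      by (simp add: sum.cartesian_product Rep_matrix_unit case_prod_unfold)
    also have "\<dots> = (if p = 0 then ?g else 0)"
      using e by (auto simp: BH_scaleC_sum image_subset_iff)
    finally show ?thesis .
  qed
  then have "(\<lambda>p. (norm (if p = 0 then ?g else 0))\<^sup>2) sums ?t\<^sup>2"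
    using tensor_norm_sums[of "{..<n} \<times> {..<m}" "\<lambda>(k, j). blinfun_apply (matrix_unit 0 k) (\<xi> j)"
        "\<lambda>(k, j). blinfun_apply (e k) (\<eta> j)"] by simp
  moreover have "(\<lambda>p. (norm (if p = 0 then ?g else 0))\<^sup>2)
      sums (\<Sum>p<Suc 0. (norm (if p = 0 then ?g else 0))\<^sup>2)"
    by (rule sums_finite) auto
  ultimately show "?t\<^sup>2 = (norm ?g)\<^sup>2"
    by (simp add: sums_unique2)
  show "0 \<le> ?t"
    by (simp add: tensor_norm_nonneg)
qed simp

lemma tensor_norm_coordinates_le:
  "(\<Sum>k<n. (norm (\<Sum>j<m. Rep_ell2 (\<xi> j) k *\<^sub>C (\<eta> j :: 'h::chilbert_space)))\<^sup>2)
    \<le> (tensor_norm {..<m::nat} \<xi> \<eta>)\<^sup>2"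
proof -
  note s = tensor_norm_sums[of "{..<m}" \<xi> \<eta>, OF finite_lessThan]
  show ?thesis
    unfolding sums_unique[OF s] by (rule sum_le_suminf[OF sums_summable[OF s]]) auto
qed

lemma tensor_norm_basis:
  fixes h :: "nat \<Rightarrow> 'h::chilbert_space"
  shows "tensor_norm {..<n} ell2_basis h = L2_set (\<lambda>k. norm (h k)) {..<n}"
proof (rule power2_eq_imp_eq)
  have *: "(\<Sum>j<n. Rep_ell2 (ell2_basis j) p *\<^sub>C h j) = (if p < n then h p else 0)" for p
    by (simp add: ell2_basis.rep_eq if_distrib if_distribR cong: if_cong)
  have "(\<lambda>p. (norm (if p < n then h p else 0))\<^sup>2) sums (tensor_norm {..<n} ell2_basis h)\<^sup>2"
    using tensor_norm_sums[of "{..<n}" ell2_basis h] by (simp add: *)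
  moreover have "(\<lambda>p. (norm (if p < n then h p else 0))\<^sup>2)
      sums (\<Sum>p<n. (norm (if p < n then h p else 0))\<^sup>2)"
    by (rule sums_finite) auto
  ultimately show "(tensor_norm {..<n} ell2_basis h)\<^sup>2 = (L2_set (\<lambda>k. norm (h k)) {..<n})\<^sup>2"
    by (simp add: L2_set_power2 sums_unique2)
qed (simp_all add: tensor_norm_nonneg L2_set_nonneg)

text \<open>Both sides are suprema of the same set: the vectors \<open>h\<close> of norm at most one arise from the tensor unit
ball as coordinates, and from the unit ball of \<open>H\<^sup>n\<close> as first entries.\<close>

lemma Phi_c_eq_column_norm:
  fixes e :: "nat \<Rightarrow> 'h::chilbert_space \<Rightarrow>\<^sub>L 'h"
  assumes e: "e ` {..<n} \<subseteq> BH" and "0 < n"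
  shows "Phi_c e n = (mat_norm n (column_matrix e))\<^sup>2"
proof -
  let ?S = "{L2_set (\<lambda>k. norm (blinfun_apply (e k) h)) {..<n} | h. norm h \<le> 1}"
  have "min_tensor_norm {..<n} (\<lambda>k. matrix_unit k 0) e = Sup ?S"
    unfolding min_tensor_norm_def column_tensor_norm[OF e]
  proof (rule arg_cong[where f = Sup], intro subset_antisym subsetI)
    fix t
    assume "t \<in> {L2_set (\<lambda>k. norm (blinfun_apply (e k) (\<Sum>j<m. Rep_ell2 (\<xi> j) 0 *\<^sub>C \<eta> j))) {..<n}
        | (m::nat) \<xi> \<eta>. tensor_norm {..<m} \<xi> \<eta> \<le> 1}"
    then obtain m :: nat and \<xi> \<eta> where t: "tensor_norm {..<m} \<xi> \<eta> \<le> 1"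
      "t = L2_set (\<lambda>k. norm (blinfun_apply (e k) (\<Sum>j<m. Rep_ell2 (\<xi> j) 0 *\<^sub>C \<eta> j))) {..<n}"
      by blast
    have "(norm (\<Sum>j<m. Rep_ell2 (\<xi> j) 0 *\<^sub>C \<eta> j))\<^sup>2 \<le> (tensor_norm {..<m} \<xi> \<eta>)\<^sup>2"
      using tensor_norm_coordinates_le[where n = 1 and m = m and \<xi> = \<xi> and \<eta> = \<eta>] by simp
    then have "norm (\<Sum>j<m. Rep_ell2 (\<xi> j) 0 *\<^sub>C \<eta> j) \<le> 1"
      using t(1) tensor_norm_nonneg[of "{..<m}" \<xi> \<eta>] by (meson finite_lessThan order_trans power2_le_imp_le)
    then show "t \<in> ?S"
      using t(2) by blast
  next
    fix t
    assume "t \<in> ?S"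
    then obtain h where h: "norm h \<le> 1" "t = L2_set (\<lambda>k. norm (blinfun_apply (e k) h)) {..<n}"
      by blast
    have "tensor_norm {..<1} ell2_basis (\<lambda>_. h) \<le> 1"
      "(\<Sum>j<(1::nat). Rep_ell2 (ell2_basis j) 0 *\<^sub>C h) = h"
      using h(1) by (simp_all add: tensor_norm_basis ell2_basis.rep_eq L2_set_def)
    with h(2) show "t \<in> {L2_set (\<lambda>k. norm (blinfun_apply (e k)
        (\<Sum>j<m. Rep_ell2 (\<xi> j) 0 *\<^sub>C \<eta> j))) {..<n} | (m::nat) \<xi> \<eta>. tensor_norm {..<m} \<xi> \<eta> \<le> 1}"
      by (intro CollectI exI[of _ "1::nat"] exI[of _ ell2_basis] exI[of _ "\<lambda>_. h"] conjI) simp_all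
  qed
  moreover have "mat_norm n (column_matrix e) = Sup ?S"
  proof -
    show ?thesis
      unfolding mat_norm_def column_matrix_apply[OF \<open>0 < n\<close>]
    proof (rule arg_cong[where f = Sup], intro subset_antisym subsetI)
      fix t
      assume "t \<in> {L2_set (\<lambda>i. norm (blinfun_apply (e i) (h 0))) {..<n} | h.
          L2_set (\<lambda>j. norm (h j)) {..<n} \<le> 1}"
      then obtain h where h: "L2_set (\<lambda>j. norm (h j)) {..<n} \<le> 1"
        "t = L2_set (\<lambda>i. norm (blinfun_apply (e i) (h 0))) {..<n}"
        by blast
      then show "t \<in> ?S"
        using member_le_L2_set[of "{..<n}" 0 "\<lambda>j. norm (h j)"] \<open>0 < n\<close> by force
    next
      fix t
      assume "t \<in> ?S"
      then obtain h where h: "norm h \<le> 1" "t = L2_set (\<lambda>k. norm (blinfun_apply (e k) h)) {..<n}"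
        by blast
      have "L2_set (\<lambda>j. norm (if j = 0 then h else 0)) {..<n} = norm h"
        using \<open>0 < n\<close> by (simp add: L2_set_def if_distrib if_distribR cong: if_cong)
      then show "t \<in> {L2_set (\<lambda>i. norm (blinfun_apply (e i) (h 0))) {..<n} | h.
          L2_set (\<lambda>j. norm (h j)) {..<n} \<le> 1}"
        using h by (auto intro!: exI[of _ "\<lambda>j::nat. if j = 0 then h else 0"])
    qed
  qed
  ultimately show ?thesis
    by (simp add: Phi_c_def)
qed

lemma Phi_r_eq_row_norm:
  fixes e :: "nat \<Rightarrow> 'h::chilbert_space \<Rightarrow>\<^sub>L 'h"
  assumes e: "e ` {..<n} \<subseteq> BH" and "0 < n"
  shows "Phi_r e n = (mat_norm n (row_matrix e))\<^sup>2"
proof -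
  have "min_tensor_norm {..<n} (\<lambda>k. matrix_unit 0 k) e = Sup {norm (\<Sum>k<n. blinfun_apply (e k) (h k))
      | h. L2_set (\<lambda>k. norm (h k)) {..<n} \<le> 1}" (is "_ = Sup ?S")
    unfolding min_tensor_norm_def row_tensor_norm[OF e]
  proof (rule arg_cong[where f = Sup], intro subset_antisym subsetI)
    fix t
    assume "t \<in> {norm (\<Sum>k<n. blinfun_apply (e k) (\<Sum>j<m. Rep_ell2 (\<xi> j) k *\<^sub>C \<eta> j))
        | (m::nat) \<xi> \<eta>. tensor_norm {..<m} \<xi> \<eta> \<le> 1}"
    then obtain m :: nat and \<xi> \<eta> where t: "tensor_norm {..<m} \<xi> \<eta> \<le> 1"
      "t = norm (\<Sum>k<n. blinfun_apply (e k) (\<Sum>j<m. Rep_ell2 (\<xi> j) k *\<^sub>C \<eta> j))"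
      by blast
    have "(L2_set (\<lambda>k. norm (\<Sum>j<m. Rep_ell2 (\<xi> j) k *\<^sub>C \<eta> j)) {..<n})\<^sup>2
        \<le> (tensor_norm {..<m} \<xi> \<eta>)\<^sup>2"
      unfolding L2_set_power2 by (rule tensor_norm_coordinates_le)
    then have "L2_set (\<lambda>k. norm (\<Sum>j<m. Rep_ell2 (\<xi> j) k *\<^sub>C \<eta> j)) {..<n} \<le> 1"
      using t(1) tensor_norm_nonneg[of "{..<m}" \<xi> \<eta>] by (meson finite_lessThan order_trans power2_le_imp_le)
    then show "t \<in> ?S"
      using t(2) by (intro CollectI exI[of _ "\<lambda>k. \<Sum>j<m. Rep_ell2 (\<xi> j) k *\<^sub>C \<eta> j"]) simp
  next
    fix t
    assume "t \<in> ?S"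
    then obtain h where h: "L2_set (\<lambda>k. norm (h k)) {..<n} \<le> 1"
      "t = norm (\<Sum>k<n. blinfun_apply (e k) (h k))"
      by blast
    have "tensor_norm {..<n} ell2_basis h \<le> 1"
      using h(1) by (simp add: tensor_norm_basis)
    moreover have "(\<Sum>j<n. Rep_ell2 (ell2_basis j) k *\<^sub>C h j) = h k" if "k < n" for k
      using that by (simp add: ell2_basis.rep_eq if_distrib if_distribR cong: if_cong)
    then have "t = norm (\<Sum>k<n. blinfun_apply (e k) (\<Sum>j<n. Rep_ell2 (ell2_basis j) k *\<^sub>C h j))"
      using h(2) by simp
    ultimately show "t \<in> {norm (\<Sum>k<n. blinfun_apply (e k) (\<Sum>j<m. Rep_ell2 (\<xi> j) k *\<^sub>C \<eta> j))
        | (m::nat) \<xi> \<eta>. tensor_norm {..<m} \<xi> \<eta> \<le> 1}"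
      by blast
  qed
  moreover have "L2_set (\<lambda>i. norm (\<Sum>j<n. blinfun_apply (row_matrix e i j) (h j))) {..<n}
      = norm (\<Sum>k<n. blinfun_apply (e k) (h k))" for h
  proof -
    let ?c = "norm (\<Sum>k<n. blinfun_apply (e k) (h k))"
    have "(norm (\<Sum>j<n. blinfun_apply (row_matrix e i j) (h j)))\<^sup>2
        = (if i = 0 then ?c\<^sup>2 else 0)" for i
      by (simp add: row_matrix_def)
    then have "(\<Sum>i<n. (norm (\<Sum>j<n. blinfun_apply (row_matrix e i j) (h j)))\<^sup>2)
        = (\<Sum>i<n. if i = 0 then ?c\<^sup>2 else 0)"
      by (rule sum.cong[OF refl])
    also have "\<dots> = ?c\<^sup>2"
      using \<open>0 < n\<close> by (subst sum.delta) auto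
    finally show ?thesis
      by (simp add: L2_set_def)
  qed
  ultimately show ?thesis
    by (simp add: Phi_r_def mat_norm_def)
qed

lemma min_tensor_norm_empty:
  "min_tensor_norm {} a x = 0"
proof -
  have "{tensor_norm ({} \<times> {..<m}) (\<lambda>(k, j). blinfun_apply (a k) (\<xi> j)) (\<lambda>(k, j). blinfun_apply (x k) (\<eta> j))
      | (m::nat) \<xi> \<eta>. tensor_norm {..<m} \<xi> \<eta> \<le> 1} = {0}"
    by (auto simp: tensor_norm_def intro!: exI[of _ "0::nat"])
  then show ?thesis
    by (simp only: min_tensor_norm_def cSup_singleton)
qed

section \<open>Contractions of a homogeneous space\<close>

lemma matrices_over_scaleR:
  assumes "operator_space F" "x \<in> matrices_over m F"
  shows "(\<lambda>i j. r *\<^sub>R x i j) \<in> matrices_over m F"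
  using assms by (auto simp: matrices_over_def operator_space_def simp flip: cscale_of_real)

lemma mat_norm_cong:
  fixes a b :: "nat \<Rightarrow> nat \<Rightarrow> 'h::chilbert_space \<Rightarrow>\<^sub>L 'h"
  assumes "\<And>i j. i < m \<Longrightarrow> j < m \<Longrightarrow> a i j = b i j"
  shows "mat_norm m a = mat_norm m b"
proof -
  have "L2_set (\<lambda>i. norm (\<Sum>j<m. blinfun_apply (a i j) (h j))) {..<m}
    = L2_set (\<lambda>i. norm (\<Sum>j<m. blinfun_apply (b i j) (h j))) {..<m}" for h
    using assms by (intro L2_set_cong arg_cong[where f = norm] sum.cong) auto
  then show ?thesis
    by (simp add: mat_norm_def)
qed

text \<open>The form in which homogeneity is used: a contraction of \<open>F\<close> contracts the norms of all matrices
over \<open>F\<close>. Complete boundedness provides the a priori bound that makes \<^const>\<open>cb_norm\<close> an honest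
best constant.\<close>

lemma homogeneous_mat_norm_le:
  fixes F :: "('h::chilbert_space \<Rightarrow>\<^sub>L 'h) set"
  assumes F: "operator_space F" "one_homogeneous F"
    and u: "bounded_linear_map F u" and le: "\<And>x. x \<in> F \<Longrightarrow> norm (u x) \<le> norm x"
    and x: "x \<in> matrices_over m F"
  shows "mat_norm m (\<lambda>i j. u (x i j)) \<le> mat_norm m x"
proof -
  define V where "V = {v :: nat \<times> (nat \<Rightarrow> nat \<Rightarrow> 'h \<Rightarrow>\<^sub>L 'h). snd v \<in> matrices_over (fst v) F}"
  define N where "N v = mat_norm (fst v) (snd v)" for v :: "nat \<times> (nat \<Rightarrow> nat \<Rightarrow> 'h \<Rightarrow>\<^sub>L 'h)"
  define P where "P v = mat_norm (fst v) (\<lambda>i j. u (snd v i j))"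
    for v :: "nat \<times> (nat \<Rightarrow> nat \<Rightarrow> 'h \<Rightarrow>\<^sub>L 'h)"
  define scl where "scl r v = (fst v, \<lambda>i j. r *\<^sub>R snd v i j)"
    for r :: real and v :: "nat \<times> (nat \<Rightarrow> nat \<Rightarrow> 'h \<Rightarrow>\<^sub>L 'h)"
  have u_scaleR: "u (r *\<^sub>R y) = r *\<^sub>R u y" if "y \<in> F" for r y
    using u that by (simp add: bounded_linear_map_def flip: cscale_of_real)
  obtain B where "\<forall>n. \<forall>x\<in>matrices_over n F. mat_norm n (\<lambda>i j. u (x i j)) \<le> B * mat_norm n x"
    using F(2) u unfolding one_homogeneous_def completely_bounded_def by blast
  then have B: "P v \<le> B * N v" if "v \<in> V" for v
    using that by (simp add: P_def N_def V_def)
  have "cb_norm F u = Sup {P v | v. v \<in> V \<and> N v \<le> 1}"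
    by (simp add: cb_norm_def P_def N_def V_def)
  moreover have "P v \<le> Sup {P v | v. v \<in> V \<and> N v \<le> 1} * N v" if "v \<in> V" for v
  proof (rule homogeneous_sup_bound[where scl = scl and ?v0.0 = v])
    fix r :: real and v
    assume v: "v \<in> V" and r: "0 \<le> r"
    show "scl r v \<in> V"
      using v by (simp add: V_def scl_def matrices_over_scaleR[OF F(1)])
    show "N (scl r v) = r * N v"
      using r by (simp add: N_def scl_def mat_norm_scaleR)
    have "mat_norm (fst v) (\<lambda>i j. u (r *\<^sub>R snd v i j)) = mat_norm (fst v) (\<lambda>i j. r *\<^sub>R u (snd v i j))"
      using v by (intro mat_norm_cong) (simp add: u_scaleR V_def matrices_over_def)
    then show "P (scl r v) = r * P v"
      using r by (simp add: P_def scl_def mat_norm_scaleR)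
  qed (use B that in \<open>auto simp: N_def mat_norm_nonneg\<close>)
  ultimately have "mat_norm m (\<lambda>i j. u (x i j)) \<le> cb_norm F u * mat_norm m x"
    using x by (force simp: V_def P_def N_def)
  moreover have "map_norm F u \<le> 1"
    unfolding map_norm_def
  proof (rule cSup_least)
    show "{norm (u x) | x. x \<in> F \<and> norm x \<le> 1} \<noteq> {}"
      using F(1) by (auto simp: operator_space_def intro!: exI[of _ "0::'h \<Rightarrow>\<^sub>L 'h"])
  qed (use le order_trans in blast)
  then have "cb_norm F u \<le> 1"
    using F(2) u unfolding one_homogeneous_def by fastforce
  ultimately show ?thesis
    using mult_right_mono[OF _ mat_norm_nonneg, of "cb_norm F u" 1 m x] by linarith
qed

section \<open>Hilbertian operator spaces\<close>

lemma bounded_functional_minus: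
  assumes "bounded_functional F f" "bounded_functional F g"
  shows "bounded_functional F (\<lambda>x. f x - g x)"
proof -
  obtain K L where K: "\<forall>x\<in>F. cmod (f x) \<le> K * norm x" and L: "\<forall>x\<in>F. cmod (g x) \<le> L * norm x"
    using assms unfolding bounded_functional_def by blast
  have "cmod (f x - g x) \<le> (K + L) * norm x" if "x \<in> F" for x
    using norm_triangle_ineq4[of "f x" "g x"] K[rule_format, OF that] L[rule_format, OF that]
    by (simp add: algebra_simps)
  then have "\<exists>K. \<forall>x\<in>F. cmod (f x - g x) \<le> K * norm x"
    by blast
  then show ?thesis
    using assms unfolding bounded_functional_def by (simp add: algebra_simps)
qed

locale hilbertian_operator_space =
  fixes F :: "('h::chilbert_space \<Rightarrow>\<^sub>L 'h) set" and ip :: "('h \<Rightarrow>\<^sub>L 'h) \<Rightarrow> ('h \<Rightarrow>\<^sub>L 'h) \<Rightarrow> complex"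
  assumes operator_space: "operator_space F" and hilbert_inner: "hilbert_inner F ip"
begin

lemma zero_mem [simp]: "0 \<in> F"
  and add_mem [simp]: "x \<in> F \<Longrightarrow> y \<in> F \<Longrightarrow> x + y \<in> F"
  and cscale_mem [simp]: "x \<in> F \<Longrightarrow> cscale c x \<in> F"
  and closed_space: "closed F"
  and mem_BH: "x \<in> F \<Longrightarrow> x \<in> BH"
  using operator_space by (auto simp: operator_space_def)

lemma scaleR_mem [simp]: "x \<in> F \<Longrightarrow> r *\<^sub>R x \<in> F"
  using cscale_mem[of x "complex_of_real r"] by (simp only: cscale_of_real)

lemma diff_mem [simp]: "x \<in> F \<Longrightarrow> y \<in> F \<Longrightarrow> x - y \<in> F"
  using add_mem[OF _ scaleR_mem[of y "-1"], of x] by (simp del: add_mem)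

lemma sum_mem [simp]: "(\<And>a. a \<in> A \<Longrightarrow> f a \<in> F) \<Longrightarrow> sum f A \<in> F"
  by (induction A rule: infinite_finite_induct) auto

lemma ip_commute: "x \<in> F \<Longrightarrow> y \<in> F \<Longrightarrow> ip x y = cnj (ip y x)"
  and ip_add_right: "x \<in> F \<Longrightarrow> y \<in> F \<Longrightarrow> z \<in> F \<Longrightarrow> ip x (y + z) = ip x y + ip x z"
  and ip_cscale_right: "x \<in> F \<Longrightarrow> y \<in> F \<Longrightarrow> ip x (cscale c y) = c * ip x y"
  and ip_self: "x \<in> F \<Longrightarrow> ip x x = complex_of_real ((norm x)\<^sup>2)"
  using hilbert_inner unfolding hilbert_inner_def by blast+

lemma ip_add_left: "x \<in> F \<Longrightarrow> y \<in> F \<Longrightarrow> z \<in> F \<Longrightarrow> ip (x + y) z = ip x z + ip y z"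
  using ip_commute[of "x + y" z] ip_commute[of x z] ip_commute[of y z] by (simp add: ip_add_right)

lemma ip_cscale_left: "x \<in> F \<Longrightarrow> y \<in> F \<Longrightarrow> ip (cscale c x) y = cnj c * ip x y"
  using ip_commute[of "cscale c x" y] ip_commute[of x y] by (simp add: ip_cscale_right)

lemma ip_zero_right [simp]: "x \<in> F \<Longrightarrow> ip x 0 = 0"
  using ip_cscale_right[of x 0 0] by simp

lemma ip_sum_right:
  "x \<in> F \<Longrightarrow> (\<And>a. a \<in> A \<Longrightarrow> f a \<in> F) \<Longrightarrow> ip x (sum f A) = (\<Sum>a\<in>A. ip x (f a))"
  by (induction A rule: infinite_finite_induct) (simp_all add: ip_add_right)

lemma norm_add_cscale:
  assumes "x \<in> F" "y \<in> F"
  shows "(norm (x + cscale c y))\<^sup>2 = (norm x)\<^sup>2 + (cmod c)\<^sup>2 * (norm y)\<^sup>2 + 2 * Re (c * ip x y)"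
proof -
  have "complex_of_real ((norm (x + cscale c y))\<^sup>2)
      = ip x x + (c * cnj c) * ip y y + (c * ip x y + cnj (c * ip x y))"
    using assms ip_commute[of y x] unfolding ip_self[symmetric, OF add_mem[OF assms(1) cscale_mem[OF assms(2)]]]
    by (simp add: ip_add_left ip_add_right ip_cscale_left ip_cscale_right algebra_simps)
  also have "\<dots> = complex_of_real ((norm x)\<^sup>2 + (cmod c)\<^sup>2 * (norm y)\<^sup>2 + 2 * Re (c * ip x y))"
    using assms by (simp only: ip_self complex_add_cnj complex_norm_square[symmetric] of_real_add of_real_mult)
  finally show ?thesis
    using of_real_eq_iff by blast
qed

lemma ip_bound:
  assumes "x \<in> F" "y \<in> F"
  shows "cmod (ip x y) \<le> norm x * norm y"
proof (cases "y = 0")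
  case True
  then show ?thesis
    using assms by simp
next
  case False
  \<comment> \<open>the minimizer of \<open>\<parallel>x + c y\<parallel>\<close>\<close>
  define c where "c = - cnj (ip x y) / complex_of_real ((norm y)\<^sup>2)"
  have c: "c * ip x y = complex_of_real (- (cmod (ip x y))\<^sup>2 / (norm y)\<^sup>2)"
    by (simp add: c_def mult.commute[of "cnj _"] complex_norm_square[symmetric] del: of_real_power)
  have "cmod c = cmod (ip x y) / (norm y)\<^sup>2"
    by (simp add: c_def norm_divide norm_power)
  then have "(cmod c)\<^sup>2 * (norm y)\<^sup>2 = (cmod (ip x y))\<^sup>2 / (norm y)\<^sup>2"
    using False by (simp add: power2_eq_square)
  then have "0 \<le> (norm x)\<^sup>2 - (cmod (ip x y))\<^sup>2 / (norm y)\<^sup>2"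
    using norm_add_cscale[OF assms, of c] zero_le_power2[of "norm (x + cscale c y)"]
    unfolding c Re_complex_of_real by simp
  then have "(cmod (ip x y))\<^sup>2 \<le> (norm x * norm y)\<^sup>2"
    using False by (simp add: field_simps)
  then show ?thesis
    by (rule power2_le_imp_le) simp
qed

lemma bounded_functional_ip: "v \<in> F \<Longrightarrow> bounded_functional F (ip v)"
  unfolding bounded_functional_def using ip_bound
  by (auto simp: ip_add_right ip_cscale_right)

text \<open>Orthonormality is relative to an index set, as a finite orthonormal family is sometimes given as
the initial segment of an arbitrary sequence.\<close>

definition orthonormal :: "nat set \<Rightarrow> (nat \<Rightarrow> 'h \<Rightarrow>\<^sub>L 'h) \<Rightarrow> bool" where
  "orthonormal A v \<longleftrightarrow> v ` A \<subseteq> F \<and> (\<forall>j\<in>A. \<forall>k\<in>A. ip (v j) (v k) = (if j = k then 1 else 0))"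

lemma orthonormal_mem: "orthonormal A v \<Longrightarrow> k \<in> A \<Longrightarrow> v k \<in> F"
  by (auto simp: orthonormal_def)

lemma ip_orthonormal_sum:
  assumes "orthonormal A v" "finite A" "j \<in> A"
  shows "ip (v j) (\<Sum>k\<in>A. cscale (c k) (v k)) = c j"
proof -
  have "ip (v j) (\<Sum>k\<in>A. cscale (c k) (v k)) = (\<Sum>k\<in>A. c k * ip (v j) (v k))"
    using assms by (simp add: ip_sum_right ip_cscale_right orthonormal_mem)
  also have "\<dots> = (\<Sum>k\<in>A. if k = j then c j else 0)"
    using assms by (intro sum.cong) (auto simp: orthonormal_def)
  finally show ?thesis
    using assms by simp
qed

lemma norm_orthonormal_sum:
  assumes "orthonormal A v" "finite A"
  shows "(norm (\<Sum>k\<in>A. cscale (c k) (v k)))\<^sup>2 = (\<Sum>k\<in>A. (cmod (c k))\<^sup>2)"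
proof -
  let ?s = "\<Sum>k\<in>A. cscale (c k) (v k)"
  have mem: "?s \<in> F"
    using assms by (simp add: orthonormal_mem)
  have "ip ?s ?s = (\<Sum>k\<in>A. ip ?s (cscale (c k) (v k)))"
    using assms by (subst ip_sum_right[OF mem]) (auto simp: orthonormal_mem)
  also have "\<dots> = (\<Sum>k\<in>A. c k * cnj (c k))"
  proof (rule sum.cong)
    fix k
    assume "k \<in> A"
    then show "ip ?s (cscale (c k) (v k)) = c k * cnj (c k)"
      using assms mem ip_commute[of ?s "v k"]
      by (simp add: ip_cscale_right orthonormal_mem ip_orthonormal_sum)
  qed simp
  also have "\<dots> = complex_of_real (\<Sum>k\<in>A. (cmod (c k))\<^sup>2)"
    by (simp add: complex_norm_square del: of_real_power)
  finally show ?thesis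
    unfolding ip_self[OF mem] of_real_eq_iff .
qed

lemma bessel:
  assumes v: "orthonormal A v" and A: "finite A" and x: "x \<in> F"
  shows "(\<Sum>k\<in>A. (cmod (ip (v k) x))\<^sup>2) \<le> (norm x)\<^sup>2"
proof -
  let ?s = "\<Sum>k\<in>A. cscale (ip (v k) x) (v k)"
  let ?q = "\<Sum>k\<in>A. (cmod (ip (v k) x))\<^sup>2"
  have mem: "?s \<in> F"
    using v by (simp add: orthonormal_mem)
  have "ip x ?s = (\<Sum>k\<in>A. ip (v k) x * ip x (v k))"
    using v x by (simp add: ip_sum_right ip_cscale_right orthonormal_mem)
  also have "\<dots> = (\<Sum>k\<in>A. ip (v k) x * cnj (ip (v k) x))"
    by (intro sum.cong refl arg_cong2[where f = "(*)"] ip_commute x orthonormal_mem[OF v])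
  also have "\<dots> = complex_of_real ?q"
    by (simp add: complex_norm_square del: of_real_power)
  finally have "Re (- 1 * ip x ?s) = - ?q"
    by simp
  then have "(norm (x + cscale (- 1) ?s))\<^sup>2 = (norm x)\<^sup>2 - ?q"
    using norm_add_cscale[OF x mem, of "- 1"] norm_orthonormal_sum[OF v A, of "\<lambda>k. ip (v k) x"] by simp
  then show ?thesis
    using zero_le_power2[of "norm (x + cscale (- 1) ?s)"] by linarith
qed

text \<open>Density and continuity: the zeros of a bounded functional form a closed complex subspace of \<open>F\<close>.\<close>

lemma functional_eq_zero:
  assumes d: "bounded_functional F d" and e: "closure (cspan (range e)) = F"
    and zero: "\<And>k. d (e k) = 0" and x: "x \<in> F"
  shows "d x = 0"
proof -
  have mem: "e k \<in> F" for k
  proof -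
    have "cscale 1 (e k) \<in> cspan (range e)"
      unfolding cspan_def by (intro span_base) blast
    then show ?thesis
      using e closure_subset by fastforce
  qed
  have d_cscale: "d (cscale c x) = c * d x" if "x \<in> F" for c x
    using d that by (simp add: bounded_functional_def)
  have d_add: "d (x + y) = d x + d y" if "x \<in> F" "y \<in> F" for x y
    using d that by (simp add: bounded_functional_def)
  obtain K where K: "\<And>x. x \<in> F \<Longrightarrow> cmod (d x) \<le> K * norm x"
    using d unfolding bounded_functional_def by blast
  have "cspan (range e) \<subseteq> {x \<in> F. d x = 0}"
    unfolding cspan_def
  proof (rule span_minimal)
    show "{cscale c T |c T. T \<in> range e} \<subseteq> {x \<in> F. d x = 0}"
      using mem zero by (auto simp: d_cscale)
    show "subspace {x \<in> F. d x = 0}"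
      unfolding subspace_def using d_cscale[of 0 0] d_add d_cscale[of _ "complex_of_real _"]
      by (auto simp: cscale_of_real)
  qed
  moreover obtain s where s: "\<And>n. s n \<in> cspan (range e)" "s \<longlonglongrightarrow> x"
    using x unfolding e[symmetric] closure_sequential by blast
  ultimately have s0: "s n \<in> F" "d (s n) = 0" for n
    by blast+
  have "cmod (d x) \<le> K * norm (x - s n)" for n
  proof -
    have "d x = d (x - s n)"
      using d_add[of "x - s n" "s n"] x s0[of n] by simp
    then show ?thesis
      using K[of "x - s n"] x s0[of n] by simp
  qed
  moreover have "(\<lambda>n. K * norm (x - s n)) \<longlonglongrightarrow> K * norm (x - x)"
    by (intro tendsto_intros s(2))
  ultimately have "cmod (d x) \<le> K * norm (x - x)"
    by (intro LIMSEQ_le_const) auto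
  then show ?thesis
    by simp
qed

text \<open>The coefficients \<open>cnj (f e\<^sub>j)\<close> are square summable, since \<open>f\<close> applied to their partial sums \<open>s\<close> gives
\<open>\<parallel>s\<parallel>\<^sup>2 \<le> K \<parallel>s\<parallel>\<close>. The resulting series converges in the ambient Banach space, hence in the closed
subspace \<open>F\<close>, and represents \<open>f\<close> on the basis.\<close>

lemma riesz_representation:
  assumes f: "bounded_functional F f" and e: "orthonormal UNIV e"
    and dense: "closure (cspan (range e)) = F"
  shows "\<exists>v\<in>F. \<forall>x\<in>F. f x = ip v x"
proof -
  define a where "a j = cnj (f (e j))" for j
  have mem: "e k \<in> F" for k
    using e by (simp add: orthonormal_mem)
  have ortho: "orthonormal A e" for A
    using e by (auto simp: orthonormal_def)
  have f_add: "f (x + y) = f x + f y" if "x \<in> F" "y \<in> F" for x y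
    using f that by (simp add: bounded_functional_def)
  have f_cscale: "f (cscale c x) = c * f x" if "x \<in> F" for c x
    using f that by (simp add: bounded_functional_def)
  have f_sum: "f (\<Sum>k\<in>A. cscale (c k) (e k)) = (\<Sum>k\<in>A. c k * f (e k))" for c and A :: "nat set"
    by (induction A rule: infinite_finite_induct)
      (use f_cscale[of 0 0] in \<open>simp_all add: f_add f_cscale mem\<close>)
  obtain K where K: "\<And>x. x \<in> F \<Longrightarrow> cmod (f x) \<le> K * norm x"
    using f unfolding bounded_functional_def by blast
  have "(\<Sum>j<N. (cmod (a j))\<^sup>2) \<le> K\<^sup>2" for N
  proof -
    let ?s = "\<Sum>j<N. cscale (a j) (e j)"
    have n: "(norm ?s)\<^sup>2 = (\<Sum>j<N. (cmod (a j))\<^sup>2)"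
      by (rule norm_orthonormal_sum[OF ortho]) simp
    have "f ?s = complex_of_real (\<Sum>j<N. (cmod (a j))\<^sup>2)"
      unfolding f_sum by (simp add: a_def complex_norm_square mult.commute del: of_real_power)
    then have "(norm ?s)\<^sup>2 \<le> K * norm ?s"
      using K[of ?s] mem by (simp add: n sum_nonneg del: of_real_sum)
    then have "norm ?s \<le> \<bar>K\<bar>"
      by (cases "norm ?s = 0") (auto simp: power2_eq_square)
    then have "(norm ?s)\<^sup>2 \<le> \<bar>K\<bar>\<^sup>2"
      by (intro power_mono) auto
    then show ?thesis
      unfolding n by simp
  qed
  then have "summable (\<lambda>j. (cmod (a j))\<^sup>2)"
    by (intro summableI_nonneg_bounded) auto
  then have "summable (\<lambda>j. cscale (a j) (e j))"
    unfolding summable_Cauchy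
  proof (intro allI impI)
    fix r :: real
    assume "r > 0" and *: "\<forall>r>0. \<exists>N. \<forall>m\<ge>N. \<forall>n. norm (\<Sum>j = m..<n. (cmod (a j))\<^sup>2) < r"
    obtain N where N: "\<And>m n. m \<ge> N \<Longrightarrow> norm (\<Sum>j = m..<n. (cmod (a j))\<^sup>2) < r\<^sup>2"
      using *[rule_format, of "r\<^sup>2"] \<open>r > 0\<close> by auto
    have "norm (\<Sum>j = m..<n. cscale (a j) (e j)) < r" if "m \<ge> N" for m n
    proof (rule power2_less_imp_less)
      show "(norm (\<Sum>j = m..<n. cscale (a j) (e j)))\<^sup>2 < r\<^sup>2"
        using N[OF that, of n] by (simp add: norm_orthonormal_sum[OF ortho] sum_nonneg)
    qed (use \<open>r > 0\<close> in simp)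
    then show "\<exists>N. \<forall>m\<ge>N. \<forall>n. norm (\<Sum>j = m..<n. cscale (a j) (e j)) < r"
      by blast
  qed
  then obtain v where v: "(\<lambda>N. \<Sum>j<N. cscale (a j) (e j)) \<longlonglongrightarrow> v"
    unfolding summable_def sums_def by blast
  have vF: "v \<in> F"
    by (rule closed_sequentially[OF closed_space _ v]) (simp add: mem)
  have "f (e k) - ip v (e k) = 0" for k
  proof -
    have "cmod (f (e k) - ip v (e k)) \<le> norm ((\<Sum>j<N. cscale (a j) (e j)) - v) * norm (e k)"
      if "N > k" for N
    proof -
      let ?s = "\<Sum>j<N. cscale (a j) (e j)"
      have "ip ?s (e k) = f (e k)"
        using ip_orthonormal_sum[OF ortho[of "{..<N}"], of k a] that
          ip_commute[of ?s "e k"] mem by (simp add: a_def)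
      moreover have "ip (?s - v) (e k) = ip ?s (e k) - ip v (e k)"
        using ip_add_left[of "?s - v" v "e k"] mem vF by simp
      ultimately show ?thesis
        using ip_bound[of "?s - v" "e k"] mem vF by simp
    qed
    moreover have "(\<lambda>N. norm ((\<Sum>j<N. cscale (a j) (e j)) - v) * norm (e k)) \<longlonglongrightarrow> norm (v - v) * norm (e k)"
      by (intro tendsto_intros v)
    ultimately have "cmod (f (e k) - ip v (e k)) \<le> norm (v - v) * norm (e k)"
      by (intro LIMSEQ_le_const) (auto intro!: exI[of _ "Suc k"])
    then show ?thesis
      by simp
  qed
  then have "f x - ip v x = 0" if "x \<in> F" for x
    using functional_eq_zero[OF bounded_functional_minus[OF f bounded_functional_ip[OF vF]] dense] that
    by blast
  then show ?thesis
    using vF by auto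
qed

text \<open>Contractivity is Bessel's inequality for \<open>v\<close> followed by Pythagoras for \<open>y\<close>. As the map annihilates
the orthogonal complement of the \<open>v\<^sub>k\<close>, finitely many coordinates suffice for the averaging below.\<close>

lemma bounded_linear_map_coordinates:
  assumes v: "orthonormal {..<n} v" and y: "orthonormal {..<n} y" and c: "\<And>k. cmod (c k) \<le> 1"
  defines "u \<equiv> \<lambda>x. \<Sum>k<n. cscale (c k * ip (v k) x) (y k)"
  shows "bounded_linear_map F u" and "\<And>x. x \<in> F \<Longrightarrow> norm (u x) \<le> norm x"
proof -
  show le: "norm (u x) \<le> norm x" if x: "x \<in> F" for x
  proof (rule power2_le_imp_le)
    have "(norm (u x))\<^sup>2 = (\<Sum>k<n. (cmod (c k * ip (v k) x))\<^sup>2)"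
      unfolding u_def by (rule norm_orthonormal_sum[OF y]) simp
    also have "\<dots> \<le> (\<Sum>k<n. (cmod (ip (v k) x))\<^sup>2)"
      using c by (intro sum_mono power_mono) (auto simp: norm_mult mult_left_le_one_le)
    also have "\<dots> \<le> (norm x)\<^sup>2"
      by (rule bessel[OF v _ x]) simp
    finally show "(norm (u x))\<^sup>2 \<le> (norm x)\<^sup>2" .
  qed simp
  have "u x \<in> F" for x
    unfolding u_def by (intro sum_mem cscale_mem orthonormal_mem[OF y])
  moreover have "u (x + x') = u x + u x'" if "x \<in> F" "x' \<in> F" for x x'
    unfolding u_def using v that
    by (simp add: ip_add_right orthonormal_mem distrib_left cscale_add_left sum.distrib)
  moreover have "u (cscale b x) = cscale b (u x)" if "x \<in> F" for b x
    unfolding u_def using v that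
    by (simp add: ip_cscale_right orthonormal_mem cscale_sum_right cscale_cscale mult.left_commute)
  ultimately show "bounded_linear_map F u"
    unfolding bounded_linear_map_def using le by (auto intro!: exI[of _ "1::real"])
qed

end

section \<open>Averaging over shifts and modulations\<close>

lemma bij_betw_shift: "bij_betw (\<lambda>t. (k + t) mod n) {..<n} {..<n::nat}"
proof -
  have inj: "inj_on (\<lambda>t. (k + t) mod n) {..<n}"
  proof (rule inj_onI)
    fix s t
    assume st: "s \<in> {..<n}" "t \<in> {..<n}" and "(k + s) mod n = (k + t) mod n"
    then have "int (k + s) mod int n = int (k + t) mod int n"
      by (metis zmod_int)
    then have "int n dvd int s - int t"
      by (simp add: mod_eq_dvd_iff)
    moreover have "\<bar>int s - int t\<bar> < int n"
      using st by auto
    ultimately have "int s - int t = 0"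
      by (metis abs_of_nat dvd_imp_le_int not_less)
    then show "s = t"
      by simp
  qed
  have "(\<lambda>t. (k + t) mod n) ` {..<n} \<subseteq> {..<n}"
    by (auto intro: mod_less_divisor)
  then have "(\<lambda>t. (k + t) mod n) ` {..<n} = {..<n}"
    by (intro card_subset_eq) (simp_all add: card_image[OF inj])
  with inj show ?thesis
    by (simp add: bij_betw_def)
qed

lemma sum_shift: "(\<Sum>t<n. f ((k + t) mod n)) = (\<Sum>j<n. f j)" for n :: nat
  by (rule sum.reindex_bij_betw[OF bij_betw_shift])

text \<open>The entries \<open>\<omega>\<^sup>k\<^sup>r\<close> of the discrete Fourier transform, \<open>\<omega> = exp (2\<pi>i/n)\<close>.\<close>

definition fourier :: "nat \<Rightarrow> nat \<Rightarrow> nat \<Rightarrow> complex" where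
  "fourier n k r = cis (2 * pi * real k / real n) ^ r"

lemma norm_fourier [simp]: "cmod (fourier n k r) = 1"
  by (simp add: fourier_def norm_power)

text \<open>A geometric sum with ratio \<open>q = \<omega>\<^sup>l\<^sup>-\<^sup>k\<close>: it vanishes because \<open>q\<^sup>n = 1\<close>, unless \<open>q = 1\<close>, which happens only
for \<open>k = l\<close> as the \<open>n\<close>-th roots of unity are distinct.\<close>

lemma fourier_orthogonal:
  assumes "k < n" "l < n"
  shows "(\<Sum>r<n. cnj (fourier n k r) * fourier n l r) = (if k = l then of_nat n else 0)"
proof -
  define z where "z k = cis (2 * pi * real k / real n)" for k
  define q where "q = cnj (z k) * z l"
  have unit: "cnj (z j) * z j = 1" for j
    by (simp add: z_def cis_cnj cis_mult)
  have root: "z j ^ n = 1" for j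
    using assms by (simp add: z_def Complex.DeMoivre)
  have sum: "(\<Sum>r<n. cnj (fourier n k r) * fourier n l r) = (\<Sum>r<n. q ^ r)"
    by (simp add: fourier_def q_def z_def power_mult_distrib)
  show ?thesis
  proof (cases "k = l")
    case True
    then show ?thesis
      unfolding sum by (simp add: q_def unit)
  next
    case False
    have "q \<noteq> 1"
    proof
      assume "q = 1"
      have "z l = (cnj (z k) * z k) * z l"
        by (simp add: unit)
      also have "\<dots> = z k"
        using \<open>q = 1\<close> by (simp add: q_def mult_ac)
      finally have "z l = z k" .
      then have "l = k"
        using Complex.bij_betw_roots_unity[of n] assms unfolding z_def bij_betw_def inj_on_def by auto
      with False show False
        by simp
    qed
    moreover have "q ^ n = 1"
      by (simp add: q_def power_mult_distrib root flip: complex_cnj_power)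
    ultimately show ?thesis
      unfolding sum using False by (simp add: geometric_sum)
  qed
qed

lemma sum_fourier_form:
  fixes y :: "nat \<Rightarrow> nat \<Rightarrow> 'h::chilbert_space"
  shows "(\<Sum>r<n. \<Sum>k<n. \<Sum>l<n. (cnj (fourier n k r) * fourier n l r) *\<^sub>C y k l)
    = of_nat n *\<^sub>C (\<Sum>k<n. y k k)"
proof -
  have "(\<Sum>r<n. \<Sum>k<n. \<Sum>l<n. (cnj (fourier n k r) * fourier n l r) *\<^sub>C y k l)
      = (\<Sum>k<n. \<Sum>l<n. \<Sum>r<n. (cnj (fourier n k r) * fourier n l r) *\<^sub>C y k l)"
    by (subst sum.swap, intro sum.cong refl sum.swap)
  also have "\<dots> = (\<Sum>k<n. \<Sum>l<n. if l = k then of_nat n *\<^sub>C y k k else 0)"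
    by (intro sum.cong refl) (simp add: fourier_orthogonal flip: scaleC_sum_left)
  finally show ?thesis
    by (simp add: scaleC_sum_right)
qed

lemma fourier_parseval:
  fixes y :: "nat \<Rightarrow> 'h::chilbert_space"
  shows "(\<Sum>r<n. (norm (\<Sum>k<n. fourier n k r *\<^sub>C y k))\<^sup>2) = real n * (\<Sum>k<n. (norm (y k))\<^sup>2)"
proof -
  have "complex_of_real (\<Sum>r<n. (norm (\<Sum>k<n. fourier n k r *\<^sub>C y k))\<^sup>2)
      = (\<Sum>r<n. \<Sum>k<n. \<Sum>l<n. cnj (fourier n k r) * fourier n l r * cinner (y k) (y l))"
    by (simp only: of_real_sum norm_sum_scaleC)
  also have "\<dots> = (\<Sum>k<n. \<Sum>l<n. \<Sum>r<n. cnj (fourier n k r) * fourier n l r * cinner (y k) (y l))"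
    by (subst sum.swap, intro sum.cong refl sum.swap)
  also have "\<dots> = (\<Sum>k<n. \<Sum>l<n. if l = k then of_nat n * cinner (y k) (y k) else 0)"
    by (intro sum.cong refl) (simp add: fourier_orthogonal flip: sum_distrib_right)
  also have "\<dots> = complex_of_real (real n * (\<Sum>k<n. (norm (y k))\<^sup>2))"
    by (simp add: cinner_self sum_distrib_left)
  finally show ?thesis
    using of_real_eq_iff by blast
qed

lemma norm_sum_power2_le:
  fixes w :: "'i \<Rightarrow> 'h::real_normed_vector"
  shows "(norm (\<Sum>a\<in>A. w a))\<^sup>2 \<le> real (card A) * (\<Sum>a\<in>A. (norm (w a))\<^sup>2)"
proof -
  have "(norm (\<Sum>a\<in>A. w a))\<^sup>2 \<le> (\<Sum>a\<in>A. norm (w a))\<^sup>2"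
    by (intro power_mono norm_sum) simp
  also have "\<dots> \<le> real (card A) * (\<Sum>a\<in>A. (norm (w a))\<^sup>2)"
    using sum_squared_le_sum_of_squares[of "\<lambda>a. norm (w a)" A] by (simp add: mult.commute)
  finally show ?thesis .
qed

context hilbertian_operator_space
begin

text \<open>A weighted partial isometry that takes \<open>v\<^sub>k\<close> to \<open>c\<^sub>k y\<^sub>k\<^sub>+\<^sub>t\<close>, indices modulo \<open>n\<close>, and kills the orthogonal
complement of the \<open>v\<^sub>k\<close>. For \<open>v = y\<close> and Fourier weights these maps act on the span of the
\<open>v\<^sub>k\<close> as products of a modulation and a cyclic shift, the generators of the finite Heisenberg group.\<close>

definition twist ::
  "nat \<Rightarrow> (nat \<Rightarrow> complex) \<Rightarrow> nat \<Rightarrow> (nat \<Rightarrow> 'h \<Rightarrow>\<^sub>L 'h) \<Rightarrow> (nat \<Rightarrow> 'h \<Rightarrow>\<^sub>L 'h) \<Rightarrow> ('h \<Rightarrow>\<^sub>L 'h) \<Rightarrow> 'h \<Rightarrow>\<^sub>L 'h" where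
  "twist n c t v y x = (\<Sum>k<n. cscale (c k * ip (v k) x) (y ((k + t) mod n)))"

lemma orthonormal_shift:
  assumes "orthonormal {..<n} y"
  shows "orthonormal {..<n} (\<lambda>k. y ((k + t) mod n))"
proof -
  have "(k + t) mod n = (l + t) mod n \<longleftrightarrow> k = l" if "k < n" "l < n" for k l
    using inj_on_eq_iff[OF bij_betw_imp_inj_on[OF bij_betw_shift[of t n]], of k l] that
    by (simp add: add.commute[of t])
  then show ?thesis
    using assms unfolding orthonormal_def by (auto simp: image_subset_iff)
qed

lemma twist_mat_norm_le:
  assumes "one_homogeneous F" "orthonormal {..<n} v" "orthonormal {..<n} y"
    and c: "\<And>k. cmod (c k) \<le> 1" and x: "x \<in> matrices_over m F"
  shows "mat_norm m (\<lambda>i j. twist n c t v y (x i j)) \<le> mat_norm m x"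
  unfolding twist_def
  using bounded_linear_map_coordinates[OF assms(2) orthonormal_shift[OF assms(3)], where c = c] c
  by (intro homogeneous_mat_norm_le[OF operator_space assms(1) _ _ x]) auto

lemma twist_apply:
  assumes "orthonormal {..<n} y"
  shows "blinfun_apply (twist n c t v y x) h
    = (\<Sum>k<n. c k *\<^sub>C blinfun_apply (y ((k + t) mod n)) (ip (v k) x *\<^sub>C h))"
proof -
  have "y ((k + t) mod n) \<in> BH" if "k < n" for k
    using assms that by (intro mem_BH orthonormal_mem[OF assms]) auto
  then show ?thesis
    unfolding twist_def BH_def by (simp add: blinfun.sum_left cscale_apply scaleC_scaleC)
qed

text \<open>Sum the contractivity estimate of the twisted matrix at the vector \<open>z \<otimes> h\<close> over all \<open>r, t < n\<close>. The sum
over the modulations \<open>r\<close> diagonalizes by Parseval's identity, the sum over the shifts \<open>t\<close> turns each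
\<open>\<parallel>y\<^sub>k\<^sub>+\<^sub>t h\<parallel>\<^sup>2\<close> into the full sum over the family \<open>y\<close>.\<close>

lemma column_twirl_le:
  assumes hom: "one_homogeneous F" and v: "orthonormal {..<n} v" and y: "orthonormal {..<n} y"
    and x: "x \<in> matrices_over m F"
  shows "(\<Sum>i<m. \<Sum>k<n. (cmod (\<Sum>j<m. ip (v k) (x i j) * z j))\<^sup>2)
      * (\<Sum>k<n. (norm (blinfun_apply (y k) h))\<^sup>2)
    \<le> real n * (mat_norm m x)\<^sup>2 * ((\<Sum>j<m. (cmod (z j))\<^sup>2) * (norm h)\<^sup>2)"
proof (cases "n = 0")
  case False
  define b where "b i k = (\<Sum>j<m. ip (v k) (x i j) * z j)" for i k
  define C where "C = (mat_norm m x)\<^sup>2 * ((\<Sum>j<m. (cmod (z j))\<^sup>2) * (norm h)\<^sup>2)"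
  have yBH: "y k \<in> BH" if "k < n" for k
    using that by (intro mem_BH orthonormal_mem[OF y]) auto
  have twisted: "(\<Sum>j<m. blinfun_apply (twist n (\<lambda>k. fourier n k r) t v y (x i j)) (z j *\<^sub>C h))
      = (\<Sum>k<n. fourier n k r *\<^sub>C (b i k *\<^sub>C blinfun_apply (y ((k + t) mod n)) h))" for r t i
  proof -
    have "(\<Sum>j<m. blinfun_apply (twist n (\<lambda>k. fourier n k r) t v y (x i j)) (z j *\<^sub>C h))
      = (\<Sum>k<n. \<Sum>j<m. fourier n k r *\<^sub>C
          blinfun_apply (y ((k + t) mod n)) ((ip (v k) (x i j) * z j) *\<^sub>C h))"
      unfolding twist_apply[OF y] by (subst sum.swap) (simp add: scaleC_scaleC)
    also have "\<dots> = (\<Sum>k<n. fourier n k r *\<^sub>C (b i k *\<^sub>C blinfun_apply (y ((k + t) mod n)) h))"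
    proof (intro sum.cong refl)
      fix k
      assume "k \<in> {..<n}"
      then have "y ((k + t) mod n) \<in> BH"
        by (intro yBH) auto
      then show "(\<Sum>j<m. fourier n k r *\<^sub>C
          blinfun_apply (y ((k + t) mod n)) ((ip (v k) (x i j) * z j) *\<^sub>C h))
        = fourier n k r *\<^sub>C (b i k *\<^sub>C blinfun_apply (y ((k + t) mod n)) h)"
        by (simp add: BH_def b_def scaleC_sum_left flip: scaleC_sum_right)
    qed
    finally show ?thesis .
  qed
  have "(\<Sum>i<m. (norm (\<Sum>k<n. fourier n k r *\<^sub>C (b i k *\<^sub>C blinfun_apply (y ((k + t) mod n)) h)))\<^sup>2) \<le> C"
    for r t
  proof -
    have "(\<Sum>i<m. (norm (\<Sum>k<n. fourier n k r *\<^sub>C (b i k *\<^sub>C blinfun_apply (y ((k + t) mod n)) h)))\<^sup>2)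
        \<le> (mat_norm m (\<lambda>i j. twist n (\<lambda>k. fourier n k r) t v y (x i j)))\<^sup>2
          * (\<Sum>j<m. (norm (z j *\<^sub>C h))\<^sup>2)"
      using mat_norm_bound[where n = m and h = "\<lambda>j. z j *\<^sub>C h"
          and T = "\<lambda>i j. twist n (\<lambda>k. fourier n k r) t v y (x i j)"]
      unfolding twisted .
    also have "\<dots> \<le> (mat_norm m x)\<^sup>2 * (\<Sum>j<m. (norm (z j *\<^sub>C h))\<^sup>2)"
      by (intro mult_right_mono power_mono twist_mat_norm_le[OF hom v y _ x] mat_norm_nonneg sum_nonneg)
        simp_all
    also have "\<dots> = C"
      by (simp add: C_def norm_scaleC power_mult_distrib sum_distrib_right)
    finally show ?thesis .
  qed
  then have "(\<Sum>t<n. \<Sum>r<n. \<Sum>i<m.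
      (norm (\<Sum>k<n. fourier n k r *\<^sub>C (b i k *\<^sub>C blinfun_apply (y ((k + t) mod n)) h)))\<^sup>2)
    \<le> (\<Sum>t<n. \<Sum>r<n. C)"
    by (intro sum_mono)
  also have "\<dots> = real n * (real n * C)"
    by simp
  also have "(\<Sum>t<n. \<Sum>r<n. \<Sum>i<m.
      (norm (\<Sum>k<n. fourier n k r *\<^sub>C (b i k *\<^sub>C blinfun_apply (y ((k + t) mod n)) h)))\<^sup>2)
    = (\<Sum>t<n. \<Sum>i<m. real n * (\<Sum>k<n. (norm (b i k *\<^sub>C blinfun_apply (y ((k + t) mod n)) h))\<^sup>2))"
    by (rule sum.cong[OF refl], subst sum.swap, simp only: fourier_parseval)
  also have "\<dots> = real n * (\<Sum>i<m. \<Sum>k<n. \<Sum>t<n. (cmod (b i k))\<^sup>2 * (norm (blinfun_apply (y ((k + t) mod n)) h))\<^sup>2)"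
  proof -
    have "(\<Sum>t<n. \<Sum>i<m. \<Sum>k<n. g t i k) = (\<Sum>i<m. \<Sum>k<n. \<Sum>t<n. g t i k)" for g :: "nat \<Rightarrow> nat \<Rightarrow> nat \<Rightarrow> real"
      by (subst sum.swap, intro sum.cong refl sum.swap)
    then show ?thesis
      by (simp add: norm_scaleC power_mult_distrib flip: sum_distrib_left)
  qed
  also have "\<dots> = real n * ((\<Sum>i<m. \<Sum>k<n. (cmod (b i k))\<^sup>2) * (\<Sum>k<n. (norm (blinfun_apply (y k) h))\<^sup>2))"
    by (simp add: sum_distrib_right sum_shift[where f = "\<lambda>j. (norm (blinfun_apply (y j) h))\<^sup>2"]
        flip: sum_distrib_left)
  finally show ?thesis
    using False by (simp add: b_def C_def mult.assoc)
qed simp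

text \<open>Now the images of the test vectors are summed before taking norms. The test vector
\<open>\<zeta>\<^sub>r\<^sub>,\<^sub>t = \<Sum>\<^sub>l \<omega>\<^sup>l\<^sup>r z\<^sub>l \<otimes> h\<^sub>l\<^sub>+\<^sub>t\<close> carries the modulation that is conjugate to the one of the operator, and the sum of
the images over all \<open>r, t < n\<close> is \<open>n (\<Sum>\<^sub>k a\<^sub>k z\<^sub>k) \<otimes> (\<Sum>\<^sub>k y\<^sub>k h\<^sub>k)\<close>. By the Cauchy-Schwarz inequality its squared norm
is at most \<open>n\<^sup>2\<close> times the sum of the squared norms of the images, and Parseval's identity evaluates the
sum of the \<open>\<parallel>\<zeta>\<^sub>r\<^sub>,\<^sub>t\<parallel>\<^sup>2\<close>.\<close>

lemma row_twirl_le: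
  assumes hom: "one_homogeneous F" and v: "orthonormal {..<n} v" and y: "orthonormal {..<n} y"
    and x: "x \<in> matrices_over m F"
  shows "(\<Sum>i<m. (cmod (\<Sum>j<m. \<Sum>k<n. ip (v k) (x i j) * z j k))\<^sup>2)
      * (norm (\<Sum>k<n. blinfun_apply (y k) (h k)))\<^sup>2
    \<le> real n * (mat_norm m x)\<^sup>2 * ((\<Sum>j<m. \<Sum>k<n. (cmod (z j k))\<^sup>2) * (\<Sum>k<n. (norm (h k))\<^sup>2))"
proof (cases "n = 0")
  case False
  define b where "b i = (\<Sum>j<m. \<Sum>k<n. ip (v k) (x i j) * z j k)" for i
  define g where "g = (\<Sum>k<n. blinfun_apply (y k) (h k))"
  define \<zeta> where "\<zeta> r t j = (\<Sum>l<n. fourier n l r *\<^sub>C (z j l *\<^sub>C h ((l + t) mod n)))" for r t j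
  define w where "w r t i = (\<Sum>j<m. blinfun_apply
    (twist n (\<lambda>k. cnj (fourier n k r)) t v y (x i j)) (\<zeta> r t j))" for r t i
  have yBH: "y ((k + t) mod n) (c *\<^sub>C f) = c *\<^sub>C y ((k + t) mod n) f" for k t c f
    using False mem_BH[OF orthonormal_mem[OF y]] by (simp add: BH_def)
  \<comment> \<open>the cross terms \<open>k \<noteq> l\<close> cancel in the sum over \<open>r\<close>; a shared shift then decouples \<open>z\<close> from \<open>h\<close>\<close>
  have sum_w: "(\<Sum>t<n. \<Sum>r<n. w r t i) = (of_nat n * b i) *\<^sub>C g" for i
  proof -
    have *: "(\<Sum>r<n. w r t i) = (\<Sum>j<m. of_nat n *\<^sub>C (\<Sum>k<n. (ip (v k) (x i j) * z j k) *\<^sub>C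
        blinfun_apply (y ((k + t) mod n)) (h ((k + t) mod n))))" for t
    proof -
      have "(\<Sum>r<n. w r t i) = (\<Sum>j<m. \<Sum>r<n. \<Sum>k<n. \<Sum>l<n. (cnj (fourier n k r) * fourier n l r) *\<^sub>C
          ((ip (v k) (x i j) * z j l) *\<^sub>C blinfun_apply (y ((k + t) mod n)) (h ((l + t) mod n))))"
        unfolding w_def twist_apply[OF y] \<zeta>_def
        by (subst sum.swap)
          (simp add: yBH blinfun.sum_right scaleC_sum_right scaleC_scaleC mult_ac)
      then show ?thesis
        by (simp only: sum_fourier_form)
    qed
    have "(\<Sum>t<n. \<Sum>r<n. w r t i) = (\<Sum>j<m. \<Sum>k<n. (of_nat n * (ip (v k) (x i j) * z j k)) *\<^sub>C
        (\<Sum>t<n. blinfun_apply (y ((k + t) mod n)) (h ((k + t) mod n))))"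
    proof -
      have swap: "(\<Sum>t<n. \<Sum>j<m. \<Sum>k<n. f t j k) = (\<Sum>j<m. \<Sum>k<n. \<Sum>t<n. f t j k)" for f :: "nat \<Rightarrow> nat \<Rightarrow> nat \<Rightarrow> 'h"
        by (subst sum.swap, intro sum.cong refl sum.swap)
      show ?thesis
        unfolding * scaleC_sum_right scaleC_scaleC swap ..
    qed
    also have "\<dots> = (of_nat n * b i) *\<^sub>C g"
      unfolding sum_shift[where f = "\<lambda>j. blinfun_apply (y j) (h j)"] g_def[symmetric]
      by (simp add: b_def sum_distrib_left scaleC_sum_left)
    finally show ?thesis .
  qed
  have "(cmod (b i))\<^sup>2 * (norm g)\<^sup>2 \<le> (\<Sum>t<n. \<Sum>r<n. (norm (w r t i))\<^sup>2)" for i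
  proof -
    have "(real n)\<^sup>2 * ((cmod (b i))\<^sup>2 * (norm g)\<^sup>2) = (norm (\<Sum>t<n. \<Sum>r<n. w r t i))\<^sup>2"
      by (simp add: sum_w norm_scaleC norm_mult power_mult_distrib)
    also have "\<dots> \<le> (real n)\<^sup>2 * (\<Sum>t<n. \<Sum>r<n. (norm (w r t i))\<^sup>2)"
      using norm_sum_power2_le[of "\<lambda>(t, r). w r t i" "{..<n} \<times> {..<n}"]
      by (simp add: sum.cartesian_product case_prod_unfold power2_eq_square)
    finally show ?thesis
      using False by simp
  qed
  then have "(\<Sum>i<m. (cmod (b i))\<^sup>2 * (norm g)\<^sup>2) \<le> (\<Sum>i<m. \<Sum>t<n. \<Sum>r<n. (norm (w r t i))\<^sup>2)"
    by (intro sum_mono)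
  also have "\<dots> = (\<Sum>t<n. \<Sum>r<n. \<Sum>i<m. (norm (w r t i))\<^sup>2)"
    by (subst sum.swap, intro sum.cong refl sum.swap)
  also have "\<dots> \<le> (\<Sum>t<n. \<Sum>r<n. (mat_norm m x)\<^sup>2 * (\<Sum>j<m. (norm (\<zeta> r t j))\<^sup>2))"
  proof (intro sum_mono)
    fix t r
    let ?T = "\<lambda>i j. twist n (\<lambda>k. cnj (fourier n k r)) t v y (x i j)"
    have "(\<Sum>i<m. (norm (w r t i))\<^sup>2) \<le> (mat_norm m ?T)\<^sup>2 * (\<Sum>j<m. (norm (\<zeta> r t j))\<^sup>2)"
      unfolding w_def by (rule mat_norm_bound)
    also have "\<dots> \<le> (mat_norm m x)\<^sup>2 * (\<Sum>j<m. (norm (\<zeta> r t j))\<^sup>2)"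
      by (intro mult_right_mono power_mono twist_mat_norm_le[OF hom v y _ x] mat_norm_nonneg sum_nonneg)
        simp_all
    finally show "(\<Sum>i<m. (norm (w r t i))\<^sup>2) \<le> (mat_norm m x)\<^sup>2 * (\<Sum>j<m. (norm (\<zeta> r t j))\<^sup>2)" .
  qed
  also have "\<dots> = (mat_norm m x)\<^sup>2 * (\<Sum>j<m. \<Sum>t<n. \<Sum>r<n. (norm (\<zeta> r t j))\<^sup>2)"
  proof -
    have "(\<Sum>t<n. \<Sum>r<n. \<Sum>j<m. f t r j) = (\<Sum>j<m. \<Sum>t<n. \<Sum>r<n. f t r j)" for f :: "nat \<Rightarrow> nat \<Rightarrow> nat \<Rightarrow> real"
      by (subst (2) sum.swap, subst sum.swap, rule refl)
    then show ?thesis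
      by (simp flip: sum_distrib_left)
  qed
  also have "(\<Sum>j<m. \<Sum>t<n. \<Sum>r<n. (norm (\<zeta> r t j))\<^sup>2)
      = (\<Sum>j<m. real n * (\<Sum>k<n. \<Sum>t<n. (cmod (z j k))\<^sup>2 * (norm (h ((k + t) mod n)))\<^sup>2))"
    unfolding \<zeta>_def fourier_parseval norm_scaleC power_mult_distrib
      sum_distrib_left[symmetric, where r = "real n"]
    by (intro sum.cong refl arg_cong2[where f = "(*)"] sum.swap)
  also have "\<dots> = real n * ((\<Sum>j<m. \<Sum>k<n. (cmod (z j k))\<^sup>2) * (\<Sum>k<n. (norm (h k))\<^sup>2))"
    by (simp add: sum_shift[where f = "\<lambda>j. (norm (h j))\<^sup>2"] sum_distrib_right
        flip: sum_distrib_left)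
  finally show ?thesis
    by (simp add: b_def g_def mult_ac sum_distrib_left)
qed simp

end

section \<open>Completely bounded norms of maps into matrices\<close>

lemma sum_pairs: "(\<Sum>q\<in>A \<times> B. f q) = (\<Sum>a\<in>A. \<Sum>b\<in>B. f (a, b))"
  by (simp add: sum.cartesian_product case_prod_unfold)

lemma norm_entry_le_mat_norm:
  fixes T :: "nat \<Rightarrow> nat \<Rightarrow> 'h::chilbert_space \<Rightarrow>\<^sub>L 'h"
  assumes "i < n" "j < n"
  shows "norm (T i j) \<le> mat_norm n T"
proof (rule norm_blinfun_bound)
  fix x :: 'h
  let ?h = "\<lambda>l. if l = j then x else 0"
  have h: "(\<Sum>l<n. blinfun_apply (T i l) (?h l)) = blinfun_apply (T i j) x" for i
    using assms by (simp add: if_distrib cong: if_cong)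
  have "(norm (blinfun_apply (T i j) x))\<^sup>2 \<le> (\<Sum>i<n. (norm (blinfun_apply (T i j) x))\<^sup>2)"
    by (rule member_le_sum[where f = "\<lambda>i. (norm (blinfun_apply (T i j) x))\<^sup>2"]) (use assms in auto)
  also have "\<dots> \<le> (mat_norm n T)\<^sup>2 * (\<Sum>l<n. (norm (?h l))\<^sup>2)"
    using mat_norm_bound[where n = n and T = T and h = ?h] unfolding h .
  also have "(\<Sum>l<n. (norm (?h l))\<^sup>2) = (norm x)\<^sup>2"
    using assms by (simp add: if_distrib if_distribR cong: if_cong)
  finally show "norm (blinfun_apply (T i j) x) \<le> mat_norm n T * norm x"
    unfolding power_mult_distrib[symmetric]
    by (rule power2_le_imp_le) (simp add: mat_norm_nonneg)
qed (rule mat_norm_nonneg)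

lemma mat_norm_1: "mat_norm 1 T = norm (T 0 0)"
proof (rule antisym)
  show "mat_norm 1 T \<le> norm (T 0 0)"
    by (rule mat_norm_least)
      (simp_all add: power_mono norm_blinfun flip: power_mult_distrib)
qed (simp add: norm_entry_le_mat_norm)

text \<open>The pairing of a dual space is only specified on \<open>F\<close>, while \<open>w\<close> is a function on all operators.\<close>

lemma cb_norm_into_Mn_cong:
  assumes "\<And>x i j. x \<in> F \<Longrightarrow> i < n \<Longrightarrow> j < n \<Longrightarrow> w x i j = w' x i j"
  shows "cb_norm_into_Mn F n w = cb_norm_into_Mn F n w'"
proof -
  have "scalar_mat_norm ({..<m} \<times> {..<n}) (\<lambda>(k, i) (l, j). w (x k l) i j)
      = scalar_mat_norm ({..<m} \<times> {..<n}) (\<lambda>(k, i) (l, j). w' (x k l) i j)"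
    if x: "x \<in> matrices_over m F" for m x
  proof -
    have "(\<Sum>q\<in>{..<m} \<times> {..<n}. (\<lambda>(k, i) (l, j). w (x k l) i j) p q * z q)
        = (\<Sum>q\<in>{..<m} \<times> {..<n}. (\<lambda>(k, i) (l, j). w' (x k l) i j) p q * z q)"
      if "p \<in> {..<m} \<times> {..<n}" for p z
      using that x by (intro sum.cong) (auto simp: matrices_over_def assms)
    then have "L2_set (\<lambda>p. cmod (\<Sum>q\<in>{..<m} \<times> {..<n}. (\<lambda>(k, i) (l, j). w (x k l) i j) p q * z q)) ({..<m} \<times> {..<n})
        = L2_set (\<lambda>p. cmod (\<Sum>q\<in>{..<m} \<times> {..<n}. (\<lambda>(k, i) (l, j). w' (x k l) i j) p q * z q)) ({..<m} \<times> {..<n})" for z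
      by (intro L2_set_cong refl) simp
    then show ?thesis
      by (simp only: scalar_mat_norm_def)
  qed
  then show ?thesis
    unfolding cb_norm_into_Mn_def by (intro arg_cong[where f = Sup]) force
qed

lemma cb_norm_into_Mn_sup:
  fixes F :: "('h::chilbert_space \<Rightarrow>\<^sub>L 'h) set" and n :: nat
    and w :: "('h \<Rightarrow>\<^sub>L 'h) \<Rightarrow> nat \<Rightarrow> nat \<Rightarrow> complex"
  defines "S \<equiv> \<lambda>m x. scalar_mat_norm ({..<m} \<times> {..<n}) (\<lambda>(k, i) (l, j). w (x k l) i j)"
  assumes F: "operator_space F"
    and w: "\<And>r x i j. x \<in> F \<Longrightarrow> i < n \<Longrightarrow> j < n \<Longrightarrow> w (r *\<^sub>R x) i j = complex_of_real r * w x i j"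
    and K: "0 \<le> K" and bound: "\<And>m x. x \<in> matrices_over m F \<Longrightarrow> S m x \<le> K * mat_norm m x"
  shows cb_norm_into_Mn_bound:
      "\<And>m x. x \<in> matrices_over m F \<Longrightarrow> S m x \<le> cb_norm_into_Mn F n w * mat_norm m x"
    and cb_norm_into_Mn_least: "cb_norm_into_Mn F n w \<le> K"
proof -
  define V where "V = {v :: nat \<times> (nat \<Rightarrow> nat \<Rightarrow> 'h \<Rightarrow>\<^sub>L 'h). snd v \<in> matrices_over (fst v) F}"
  define N where "N v = mat_norm (fst v) (snd v)" for v :: "nat \<times> (nat \<Rightarrow> nat \<Rightarrow> 'h \<Rightarrow>\<^sub>L 'h)"
  define P where "P v = S (fst v) (snd v)" for v :: "nat \<times> (nat \<Rightarrow> nat \<Rightarrow> 'h \<Rightarrow>\<^sub>L 'h)"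
  define scl where "scl r v = (fst v, \<lambda>i j. r *\<^sub>R snd v i j)"
    for r :: real and v :: "nat \<times> (nat \<Rightarrow> nat \<Rightarrow> 'h \<Rightarrow>\<^sub>L 'h)"
  have M: "cb_norm_into_Mn F n w = Sup {P v | v. v \<in> V \<and> N v \<le> 1}"
    by (simp add: cb_norm_into_Mn_def P_def N_def V_def S_def)
  have v0: "(0, \<lambda>_ _. 0) \<in> V"
    by (simp add: V_def matrices_over_def)
  have scl: "scl r v \<in> V" if "v \<in> V" for r v
    using that by (simp add: V_def scl_def matrices_over_scaleR[OF F])
  have N: "N (scl r v) = r * N v" if "r \<ge> 0" for r v
    using that by (simp add: N_def scl_def mat_norm_scaleR)
  have P: "P (scl r v) = r * P v" if v: "v \<in> V" and r: "r \<ge> 0" for r v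
  proof -
    obtain m x where vmx: "v = (m, x)" and x: "x \<in> matrices_over m F"
      using v by (cases v) (auto simp: V_def)
    let ?I = "{..<m} \<times> {..<n}"
    let ?A = "\<lambda>(k, i) (l, j). w (x k l) i j"
    have "(\<Sum>q\<in>?I. (\<lambda>(k, i) (l, j). w (r *\<^sub>R x k l) i j) p q * z q)
        = (\<Sum>q\<in>?I. (complex_of_real r * ?A p q) * z q)" if "p \<in> ?I" for p z
      using that x by (intro sum.cong) (auto simp: matrices_over_def w)
    then have "L2_set (\<lambda>p. cmod (\<Sum>q\<in>?I. (\<lambda>(k, i) (l, j). w (r *\<^sub>R x k l) i j) p q * z q)) ?I
        = L2_set (\<lambda>p. cmod (\<Sum>q\<in>?I. (complex_of_real r * ?A p q) * z q)) ?I" for z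
      by (intro L2_set_cong refl) simp
    then have "S m (\<lambda>k l. r *\<^sub>R x k l) = scalar_mat_norm ?I (\<lambda>p q. complex_of_real r * ?A p q)"
      by (simp only: S_def scalar_mat_norm_def)
    also have "\<dots> = r * S m x"
      unfolding S_def by (rule scalar_mat_norm_scale) (use r in auto)
    finally show ?thesis
      by (simp add: P_def scl_def vmx)
  qed
  have pos: "0 \<le> N v" for v
    by (simp add: N_def mat_norm_nonneg)
  have B: "P v \<le> K * N v" if "v \<in> V" for v
    using bound that by (simp add: P_def N_def V_def)
  note sup = homogeneous_sup[of _ V scl N P K, OF v0 scl N P pos B, folded M]
  show "S m x \<le> cb_norm_into_Mn F n w * mat_norm m x" if "x \<in> matrices_over m F" for m x
  proof -
    have "P (m, x) \<le> cb_norm_into_Mn F n w * N (m, x)"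
      by (rule sup(2)) (use that in \<open>auto simp: V_def\<close>)
    then show ?thesis
      by (simp add: P_def N_def)
  qed
  show "cb_norm_into_Mn F n w \<le> K"
    by (rule sup(3)) (use K B in auto)
qed

section \<open>Coordinate functionals as maps into columns and rows\<close>

context hilbertian_operator_space
begin

text \<open>The supremum over \<open>h\<close> in \<open>column_twirl_le\<close>.\<close>

lemma column_norm_twirl_le:
  assumes hom: "one_homogeneous F" and v: "orthonormal {..<n} v" and y: "orthonormal {..<n} y"
    and x: "x \<in> matrices_over m F" and n: "0 < n"
  shows "(\<Sum>i<m. \<Sum>k<n. (cmod (\<Sum>j<m. ip (v k) (x i j) * z j))\<^sup>2)
      * (mat_norm n (column_matrix y))\<^sup>2
    \<le> real n * (mat_norm m x)\<^sup>2 * (\<Sum>j<m. (cmod (z j))\<^sup>2)" (is "?A * _ \<le> ?B")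
proof (cases "?A = 0")
  case True
  then show ?thesis
    by (simp add: sum_nonneg)
next
  case False
  then have A: "0 < ?A"
    by (simp add: sum_nonneg less_le)
  have B: "0 \<le> ?B"
    by (simp add: sum_nonneg)
  have "mat_norm n (column_matrix y) \<le> sqrt (?B / ?A)"
  proof (rule mat_norm_least)
    fix h :: "nat \<Rightarrow> 'h"
    have "?A * (\<Sum>k<n. (norm (blinfun_apply (y k) (h 0)))\<^sup>2) \<le> ?B * (norm (h 0))\<^sup>2"
      using column_twirl_le[OF hom v y x, of z "h 0"] by (simp add: mult.assoc)
    also have "\<dots> \<le> ?B * (\<Sum>j<n. (norm (h j))\<^sup>2)"
      using n B by (intro mult_left_mono member_le_sum) auto
    finally show "(\<Sum>i<n. (norm (\<Sum>j<n. blinfun_apply (column_matrix y i j) (h j)))\<^sup>2)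
        \<le> (sqrt (?B / ?A))\<^sup>2 * (\<Sum>j<n. (norm (h j))\<^sup>2)"
      using A B n by (simp add: column_matrix_apply pos_le_divide_eq mult.commute)
  qed (use A B in simp)
  then have "(mat_norm n (column_matrix y))\<^sup>2 \<le> (sqrt (?B / ?A))\<^sup>2"
    by (intro power_mono mat_norm_nonneg)
  then show ?thesis
    using A B by (simp add: pos_le_divide_eq mult.commute)
qed

text \<open>The supremum over \<open>h\<close> in \<open>row_twirl_le\<close>.\<close>

lemma row_norm_twirl_le:
  assumes hom: "one_homogeneous F" and v: "orthonormal {..<n} v" and y: "orthonormal {..<n} y"
    and x: "x \<in> matrices_over m F" and n: "0 < n"
  shows "(\<Sum>i<m. (cmod (\<Sum>j<m. \<Sum>k<n. ip (v k) (x i j) * z j k))\<^sup>2)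
      * (mat_norm n (row_matrix y))\<^sup>2
    \<le> real n * (mat_norm m x)\<^sup>2 * (\<Sum>j<m. \<Sum>k<n. (cmod (z j k))\<^sup>2)" (is "?A * _ \<le> ?B")
proof (cases "?A = 0")
  case True
  then show ?thesis
    by (simp add: sum_nonneg)
next
  case False
  then have A: "0 < ?A"
    by (simp add: sum_nonneg less_le)
  have B: "0 \<le> ?B"
    by (simp add: sum_nonneg)
  have "mat_norm n (row_matrix y) \<le> sqrt (?B / ?A)"
  proof (rule mat_norm_least)
    fix h :: "nat \<Rightarrow> 'h"
    have "(\<Sum>i<n. (norm (\<Sum>j<n. blinfun_apply (row_matrix y i j) (h j)))\<^sup>2)
        = (\<Sum>i<n. if i = 0 then (norm (\<Sum>j<n. blinfun_apply (y j) (h j)))\<^sup>2 else 0)"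
      by (intro sum.cong refl) (simp add: row_matrix_apply)
    also have "\<dots> = (norm (\<Sum>j<n. blinfun_apply (y j) (h j)))\<^sup>2"
      using n by (subst sum.delta) auto
    finally show "(\<Sum>i<n. (norm (\<Sum>j<n. blinfun_apply (row_matrix y i j) (h j)))\<^sup>2)
        \<le> (sqrt (?B / ?A))\<^sup>2 * (\<Sum>j<n. (norm (h j))\<^sup>2)"
      using row_twirl_le[OF hom v y x, of z h] A B
      by (simp add: pos_le_divide_eq mult.commute mult.left_commute mult.assoc)
  qed (use A B in simp)
  then have "(mat_norm n (row_matrix y))\<^sup>2 \<le> (sqrt (?B / ?A))\<^sup>2"
    by (intro power_mono mat_norm_nonneg)
  then show ?thesis
    using A B by (simp add: pos_le_divide_eq mult.commute)
qed

lemma orthonormal_norm: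
  assumes "orthonormal A v" "k \<in> A"
  shows "norm (v k) = 1"
proof -
  have "complex_of_real ((norm (v k))\<^sup>2) = 1"
    using assms by (simp add: orthonormal_def ip_self[symmetric] image_subset_iff del: of_real_power)
  then have "(norm (v k))\<^sup>2 = 1"
    using of_real_eq_1_iff by blast
  then show ?thesis
    by (simp add: power2_eq_1_iff) (metis norm_ge_zero not_one_le_zero neg_0_le_iff_le)
qed

text \<open>The contraction that takes \<open>y\<^sub>k\<close> to \<open>v\<^sub>k\<close> is a complete contraction. By symmetry, column and row norms
do not depend on the orthonormal family.\<close>

lemma change_of_basis:
  assumes hom: "one_homogeneous F" and v: "orthonormal {..<n} v" and y: "orthonormal {..<n} y"
  shows "mat_norm n (column_matrix v) \<le> mat_norm n (column_matrix y)"
    and "mat_norm n (row_matrix v) \<le> mat_norm n (row_matrix y)"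
proof -
  define u where "u x = (\<Sum>k<n. cscale (1 * ip (y k) x) (v k))" for x
  have u: "bounded_linear_map F u" "\<And>x. x \<in> F \<Longrightarrow> norm (u x) \<le> norm x"
    unfolding u_def using bounded_linear_map_coordinates[OF y v, where c = "\<lambda>_. 1"] by auto
  have uy: "u (y i) = v i" if "i < n" for i
  proof -
    have "u (y i) = (\<Sum>k<n. if k = i then v i else 0)"
      unfolding u_def using y that by (intro sum.cong) (auto simp: orthonormal_def)
    then show ?thesis
      using that by simp
  qed
  have u0: "u 0 = 0"
    unfolding u_def using y by (intro sum.neutral) (simp add: orthonormal_mem)
  have "mat_norm n (column_matrix v) = mat_norm n (\<lambda>i j. u (column_matrix y i j))"
    by (rule mat_norm_cong) (simp add: column_matrix_def uy u0)
  also have "\<dots> \<le> mat_norm n (column_matrix y)"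
    using y by (intro homogeneous_mat_norm_le[OF operator_space hom u])
      (auto simp: matrices_over_def column_matrix_def orthonormal_mem)
  finally show "mat_norm n (column_matrix v) \<le> mat_norm n (column_matrix y)" .
  have "mat_norm n (row_matrix v) = mat_norm n (\<lambda>i j. u (row_matrix y i j))"
    by (rule mat_norm_cong) (simp add: row_matrix_def uy u0)
  also have "\<dots> \<le> mat_norm n (row_matrix y)"
    using y by (intro homogeneous_mat_norm_le[OF operator_space hom u])
      (auto simp: matrices_over_def row_matrix_def orthonormal_mem)
  finally show "mat_norm n (row_matrix v) \<le> mat_norm n (row_matrix y)" .
qed

text \<open>The map \<open>x \<mapsto> (\<langle>v\<^sub>i, x\<rangle>)\<^sub>i\<close> into columns has cb-norm at most \<open>\<surd>n / P\<close>: only the entries \<open>z(l, 0)\<close> of a test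
vector meet the nonzero column, and for these the estimate is \<open>column_norm_twirl_le\<close>.\<close>

lemma column_functional_le:
  assumes hom: "one_homogeneous F" and v: "orthonormal {..<n} v" and y: "orthonormal {..<n} y"
    and x: "x \<in> matrices_over m F" and n: "0 < n"
    and P: "P = mat_norm n (column_matrix y)" "0 < P"
  shows "scalar_mat_norm ({..<m} \<times> {..<n})
      (\<lambda>(k, i) (l, j). column_matrix (\<lambda>i. ip (v i) (x k l)) i j) \<le> sqrt (real n) / P * mat_norm m x"
proof (rule scalar_mat_norm_least)
  fix z :: "nat \<times> nat \<Rightarrow> complex"
  have "(\<Sum>l<m. \<Sum>j<n. column_matrix (\<lambda>i. ip (v i) (x k l)) i j * z (l, j))
      = (\<Sum>l<m. ip (v i) (x k l) * z (l, 0))" for k i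
  proof (rule sum.cong[OF refl])
    fix l
    have "(\<Sum>j<n. column_matrix (\<lambda>i. ip (v i) (x k l)) i j * z (l, j))
        = (\<Sum>j<n. if j = 0 then ip (v i) (x k l) * z (l, 0) else 0)"
      by (intro sum.cong) (auto simp: column_matrix_def)
    then show "(\<Sum>j<n. column_matrix (\<lambda>i. ip (v i) (x k l)) i j * z (l, j))
        = ip (v i) (x k l) * z (l, 0)"
      using n by simp
  qed
  then have "(\<Sum>p\<in>{..<m} \<times> {..<n}. (cmod (\<Sum>q\<in>{..<m} \<times> {..<n}.
      (\<lambda>(k, i) (l, j). column_matrix (\<lambda>i. ip (v i) (x k l)) i j) p q * z q))\<^sup>2)
    = (\<Sum>k<m. \<Sum>i<n. (cmod (\<Sum>l<m. ip (v i) (x k l) * z (l, 0)))\<^sup>2)"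
    by (simp only: sum_pairs prod.case)
  also have "\<dots> \<le> (sqrt (real n) / P * mat_norm m x)\<^sup>2 * (\<Sum>l<m. (cmod (z (l, 0)))\<^sup>2)"
    using column_norm_twirl_le[OF hom v y x n, of "\<lambda>l. z (l, 0)"] P(2) unfolding P(1)[symmetric]
    by (simp add: power_mult_distrib power_divide field_simps)
  also have "\<dots> \<le> (sqrt (real n) / P * mat_norm m x)\<^sup>2 * (\<Sum>l<m. \<Sum>j<n. (cmod (z (l, j)))\<^sup>2)"
  proof (intro mult_left_mono sum_mono)
    fix l
    show "(cmod (z (l, 0)))\<^sup>2 \<le> (\<Sum>j<n. (cmod (z (l, j)))\<^sup>2)"
      using n member_le_sum[of 0 "{..<n}" "\<lambda>j. (cmod (z (l, j)))\<^sup>2"] by simp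
  qed simp
  finally show "(\<Sum>p\<in>{..<m} \<times> {..<n}. (cmod (\<Sum>q\<in>{..<m} \<times> {..<n}.
      (\<lambda>(k, i) (l, j). column_matrix (\<lambda>i. ip (v i) (x k l)) i j) p q * z q))\<^sup>2)
    \<le> (sqrt (real n) / P * mat_norm m x)\<^sup>2 * (\<Sum>q\<in>{..<m} \<times> {..<n}. (cmod (z q))\<^sup>2)"
    by (simp only: sum_pairs)
qed (use P in \<open>simp_all add: mat_norm_nonneg\<close>)

lemma row_functional_le:
  assumes hom: "one_homogeneous F" and v: "orthonormal {..<n} v" and y: "orthonormal {..<n} y"
    and x: "x \<in> matrices_over m F" and n: "0 < n"
    and P: "P = mat_norm n (row_matrix y)" "0 < P"
  shows "scalar_mat_norm ({..<m} \<times> {..<n})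
      (\<lambda>(k, i) (l, j). row_matrix (\<lambda>j. ip (v j) (x k l)) i j) \<le> sqrt (real n) / P * mat_norm m x"
proof (rule scalar_mat_norm_least)
  fix z :: "nat \<times> nat \<Rightarrow> complex"
  have "(\<Sum>i<n. (cmod (\<Sum>l<m. \<Sum>j<n. row_matrix (\<lambda>j. ip (v j) (x k l)) i j * z (l, j)))\<^sup>2)
      = (cmod (\<Sum>l<m. \<Sum>j<n. ip (v j) (x k l) * z (l, j)))\<^sup>2" for k
  proof -
    have "(\<Sum>i<n. (cmod (\<Sum>l<m. \<Sum>j<n. row_matrix (\<lambda>j. ip (v j) (x k l)) i j * z (l, j)))\<^sup>2)
        = (\<Sum>i<n. if i = 0 then (cmod (\<Sum>l<m. \<Sum>j<n. ip (v j) (x k l) * z (l, j)))\<^sup>2 else 0)"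
      by (intro sum.cong refl) (simp add: row_matrix_def)
    also have "\<dots> = (cmod (\<Sum>l<m. \<Sum>j<n. ip (v j) (x k l) * z (l, j)))\<^sup>2"
      using n by (subst sum.delta) auto
    finally show ?thesis .
  qed
  then have "(\<Sum>p\<in>{..<m} \<times> {..<n}. (cmod (\<Sum>q\<in>{..<m} \<times> {..<n}.
      (\<lambda>(k, i) (l, j). row_matrix (\<lambda>j. ip (v j) (x k l)) i j) p q * z q))\<^sup>2)
    = (\<Sum>k<m. (cmod (\<Sum>l<m. \<Sum>j<n. ip (v j) (x k l) * z (l, j)))\<^sup>2)"
    by (simp only: sum_pairs prod.case)
  also have "\<dots> \<le> (sqrt (real n) / P * mat_norm m x)\<^sup>2 * (\<Sum>l<m. \<Sum>j<n. (cmod (z (l, j)))\<^sup>2)"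
    using row_norm_twirl_le[OF hom v y x n, of "\<lambda>l j. z (l, j)"] P(2) unfolding P(1)[symmetric]
    by (simp add: power_mult_distrib power_divide field_simps)
  finally show "(\<Sum>p\<in>{..<m} \<times> {..<n}. (cmod (\<Sum>q\<in>{..<m} \<times> {..<n}.
      (\<lambda>(k, i) (l, j). row_matrix (\<lambda>j. ip (v j) (x k l)) i j) p q * z q))\<^sup>2)
    \<le> (sqrt (real n) / P * mat_norm m x)\<^sup>2 * (\<Sum>q\<in>{..<m} \<times> {..<n}. (cmod (z q))\<^sup>2)"
    by (simp only: sum_pairs)
qed (use P in \<open>simp_all add: mat_norm_nonneg\<close>)

text \<open>For the lower bound the map is applied to the column of the \<open>v\<^sub>k\<close>: the result has the entries
\<open>\<langle>v\<^sub>i, v\<^sub>k\<rangle>\<close> in its first column, hence norm at least \<open>\<surd>n\<close>.\<close>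

lemma dual_column_norm:
  assumes hom: "one_homogeneous F" and v: "orthonormal {..<n} v" and y: "orthonormal {..<n} y"
    and n: "0 < n"
  shows "cb_norm_into_Mn F n (\<lambda>x. column_matrix (\<lambda>i. ip (v i) x))
    * mat_norm n (column_matrix y) = sqrt (real n)" (is "?cb * _ = _")
proof (rule antisym)
  define P where "P = mat_norm n (column_matrix y)"
  let ?I = "{..<n} \<times> {..<n}"
  let ?A = "\<lambda>(k, i) (l, j). column_matrix (\<lambda>i. ip (v i) (column_matrix v k l)) i j"
  have "norm (column_matrix y 0 0) \<le> P"
    unfolding P_def using n by (intro norm_entry_le_mat_norm)
  then have P: "0 < P"
    using orthonormal_norm[OF y, of 0] n by (simp add: column_matrix_def)
  have w: "column_matrix (\<lambda>i. ip (v i) (r *\<^sub>R x)) i j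
      = complex_of_real r * column_matrix (\<lambda>i. ip (v i) x) i j" if "x \<in> F" "i < n" for r x i j
    using that orthonormal_mem[OF v]
    by (simp add: column_matrix_def ip_cscale_right flip: cscale_of_real)
  note cb = cb_norm_into_Mn_sup[OF operator_space w _
      column_functional_le[OF hom v y _ n P_def P]]
  have "?cb \<le> sqrt (real n) / P"
    by (rule cb(2)) (use P in auto)
  then show "?cb * mat_norm n (column_matrix y) \<le> sqrt (real n)"
    using P by (simp add: P_def[symmetric] pos_le_divide_eq)
  have vF: "column_matrix v \<in> matrices_over n F"
    using v by (auto simp: matrices_over_def column_matrix_def orthonormal_mem)
  have "scalar_mat_norm ?I ?A \<le> ?cb * mat_norm n (column_matrix v)"
    by (rule cb(1)) (use P vF in auto)
  have one: "?A (k, i) (0, 0) = (if i = k then 1 else 0)" if "k < n" "i < n" for k i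
    using v that by (simp add: column_matrix_def orthonormal_def)
  let ?z = "\<lambda>q::nat \<times> nat. if q = (0, 0) then 1 else 0 :: complex"
  have Az: "(\<Sum>q\<in>?I. ?A p q * ?z q) = ?A p (0, 0)" for p
    using n by (subst sum.cong[OF refl, where h = "\<lambda>q. if q = (0, 0) then ?A p (0, 0) else 0"])
      (auto simp: sum.delta)
  have "real n = (\<Sum>p\<in>?I. (cmod (?A p (0, 0)))\<^sup>2)"
  proof -
    have "(\<Sum>p\<in>?I. (cmod (?A p (0, 0)))\<^sup>2) = (\<Sum>k<n. \<Sum>i<n. if i = k then 1 else 0)"
      unfolding sum_pairs by (intro sum.cong refl) (simp only: one lessThan_iff split: if_split, simp)
    then show ?thesis
      by simp
  qed
  also have "\<dots> = (\<Sum>p\<in>?I. (cmod (\<Sum>q\<in>?I. ?A p q * ?z q))\<^sup>2)"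
    by (simp only: Az)
  also have "\<dots> \<le> (scalar_mat_norm ?I ?A)\<^sup>2 * (\<Sum>q\<in>?I. (cmod (?z q))\<^sup>2)"
    by (rule scalar_mat_norm_bound) simp
  also have "(\<Sum>q\<in>?I. (cmod (?z q))\<^sup>2) = 1"
    using n by (subst sum.cong[OF refl, where h = "\<lambda>q. if q = (0, 0) then 1 else 0"])
      (auto simp: sum.delta)
  finally have "sqrt (real n) \<le> scalar_mat_norm ?I ?A"
    by (intro real_le_lsqrt) (simp_all add: scalar_mat_norm_nonneg)
  also have "\<dots> \<le> ?cb * mat_norm n (column_matrix v)"
    by fact
  also have "\<dots> \<le> ?cb * mat_norm n (column_matrix y)"
  proof (rule mult_left_mono[OF change_of_basis(1)[OF hom v y]])
    have "0 \<le> ?cb * mat_norm n (column_matrix v)"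
      by (rule order.trans[OF _ calculation]) simp
    moreover have "0 < mat_norm n (column_matrix v)"
      using norm_entry_le_mat_norm[of 0 n 0 "column_matrix v"] orthonormal_norm[OF v, of 0] n
      by (simp add: column_matrix_def)
    ultimately show "0 \<le> ?cb"
      by (simp add: zero_le_mult_iff)
  qed
  finally show "sqrt (real n) \<le> ?cb * mat_norm n (column_matrix y)" .
qed

text \<open>For the lower bound the map is applied to the row of the \<open>v\<^sub>k\<close>. The first row of the result has the
entries \<open>\<langle>v\<^sub>j, v\<^sub>l\<rangle>\<close>; tested on the diagonal vector, of norm \<open>\<surd>n\<close>, it gives \<open>n\<close>.\<close>

lemma dual_row_norm:
  assumes hom: "one_homogeneous F" and v: "orthonormal {..<n} v" and y: "orthonormal {..<n} y"
    and n: "0 < n"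
  shows "cb_norm_into_Mn F n (\<lambda>x. row_matrix (\<lambda>j. ip (v j) x))
    * mat_norm n (row_matrix y) = sqrt (real n)" (is "?cb * _ = _")
proof (rule antisym)
  define P where "P = mat_norm n (row_matrix y)"
  let ?I = "{..<n} \<times> {..<n}"
  let ?A = "\<lambda>(k, i) (l, j). row_matrix (\<lambda>j. ip (v j) (row_matrix v k l)) i j"
  have "norm (row_matrix y 0 0) \<le> P"
    unfolding P_def using n by (intro norm_entry_le_mat_norm)
  then have P: "0 < P"
    using orthonormal_norm[OF y, of 0] n by (simp add: row_matrix_def)
  have w: "row_matrix (\<lambda>j. ip (v j) (r *\<^sub>R x)) i j
      = complex_of_real r * row_matrix (\<lambda>j. ip (v j) x) i j" if "x \<in> F" "i < n" "j < n" for r x i j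
    using that orthonormal_mem[OF v]
    by (simp add: row_matrix_def ip_cscale_right flip: cscale_of_real)
  note cb = cb_norm_into_Mn_sup[OF operator_space w _
      row_functional_le[OF hom v y _ n P_def P]]
  have "?cb \<le> sqrt (real n) / P"
    by (rule cb(2)) (use P in auto)
  then show "?cb * mat_norm n (row_matrix y) \<le> sqrt (real n)"
    using P by (simp add: P_def[symmetric] pos_le_divide_eq)
  have vF: "row_matrix v \<in> matrices_over n F"
    using v by (auto simp: matrices_over_def row_matrix_def orthonormal_mem)
  have "scalar_mat_norm ?I ?A \<le> ?cb * mat_norm n (row_matrix v)"
    by (rule cb(1)) (use P vF in auto)
  let ?z = "\<lambda>(l, j). if l = j then 1 else 0 :: complex"
  have "(\<Sum>q\<in>?I. ?A (0, 0) q * ?z q) = of_nat n"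
  proof -
    have "(\<Sum>q\<in>?I. ?A (0, 0) q * ?z q) = (\<Sum>l<n. \<Sum>j<n. if l = j then 1 else 0)"
      unfolding sum_pairs using v by (intro sum.cong refl) (simp add: row_matrix_def orthonormal_def)
    then show ?thesis
      by simp
  qed
  then have "real n * real n = (cmod (\<Sum>q\<in>?I. ?A (0, 0) q * ?z q))\<^sup>2"
    by (simp add: power2_eq_square)
  also have "\<dots> \<le> (\<Sum>p\<in>?I. (cmod (\<Sum>q\<in>?I. ?A p q * ?z q))\<^sup>2)"
    using n by (intro member_le_sum[where f = "\<lambda>p. (cmod (\<Sum>q\<in>?I. ?A p q * ?z q))\<^sup>2"]) auto
  also have "\<dots> \<le> (scalar_mat_norm ?I ?A)\<^sup>2 * (\<Sum>q\<in>?I. (cmod (?z q))\<^sup>2)"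
    by (rule scalar_mat_norm_bound) simp
  also have "(\<Sum>q\<in>?I. (cmod (?z q))\<^sup>2) = (\<Sum>l<n. \<Sum>j<n. if l = j then 1 else 0)"
    unfolding sum_pairs by (intro sum.cong refl) simp
  also have "\<dots> = real n"
    by simp
  finally have "sqrt (real n) \<le> scalar_mat_norm ?I ?A"
    using n by (intro real_le_lsqrt) (simp_all add: scalar_mat_norm_nonneg)
  also have "\<dots> \<le> ?cb * mat_norm n (row_matrix v)"
    by fact
  also have "\<dots> \<le> ?cb * mat_norm n (row_matrix y)"
  proof (rule mult_left_mono[OF change_of_basis(2)[OF hom v y]])
    have "0 \<le> ?cb * mat_norm n (row_matrix v)"
      by (rule order.trans[OF _ calculation]) simp
    moreover have "0 < mat_norm n (row_matrix v)"
      using norm_entry_le_mat_norm[of 0 n 0 "row_matrix v"] orthonormal_norm[OF v, of 0] n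
      by (simp add: row_matrix_def)
    ultimately show "0 \<le> ?cb"
      by (simp add: zero_le_mult_iff)
  qed
  finally show "sqrt (real n) \<le> ?cb * mat_norm n (row_matrix y)" .
qed

end

section \<open>Orthonormal bases of the dual\<close>

context hilbertian_operator_space
begin

text \<open>The identification of \<open>F\<^sup>*\<close> with \<open>F\<close> is isometric, that is, the cb-norm of a functional is its norm. For a
functional \<open>\<langle>w, \<cdot>\<rangle>\<close> with a unit vector \<open>w\<close> this is the case \<open>n = 1\<close> of \<open>dual_column_norm\<close>.\<close>

lemma norm_dual_element:
  fixes G :: "('k::chilbert_space \<Rightarrow>\<^sub>L 'k) set"
  assumes hom: "one_homogeneous F"
    and cscale: "\<And>c g x. g \<in> G \<Longrightarrow> x \<in> F \<Longrightarrow> \<phi> (cscale c g) x = c * \<phi> g x"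
    and unique: "\<And>\<psi>. bounded_functional F \<psi> \<Longrightarrow> \<exists>!g. g \<in> G \<and> (\<forall>x\<in>F. \<phi> g x = \<psi> x)"
    and norm: "\<And>n g. g \<in> matrices_over n G \<Longrightarrow>
      mat_norm n g = cb_norm_into_Mn F n (\<lambda>x i j. \<phi> (g i j) x)"
    and G: "operator_space G" and g: "g \<in> G" and w: "w \<in> F" and gw: "\<And>x. x \<in> F \<Longrightarrow> \<phi> g x = ip w x"
  shows "norm g = norm w"
proof -
  have unit: "norm g = 1"
    if g: "g \<in> G" and w: "w \<in> F" and gw: "\<And>x. x \<in> F \<Longrightarrow> \<phi> g x = ip w x" and nw: "norm w = 1"
    for g w
  proof -
    have on: "orthonormal {..<1} (\<lambda>_. w)"
      using w nw by (auto simp: orthonormal_def ip_self)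
    have "norm g = mat_norm 1 (\<lambda>_ _. g)"
      by (simp only: mat_norm_1)
    also have "\<dots> = cb_norm_into_Mn F 1 (\<lambda>x i j. \<phi> g x)"
      by (rule norm) (simp add: matrices_over_def g)
    also have "\<dots> = cb_norm_into_Mn F 1 (\<lambda>x. column_matrix (\<lambda>i. ip w x))"
      by (rule cb_norm_into_Mn_cong) (simp add: column_matrix_def gw)
    also have "\<dots> = cb_norm_into_Mn F 1 (\<lambda>x. column_matrix (\<lambda>i. ip w x))
        * mat_norm 1 (column_matrix (\<lambda>_. w))"
      by (simp only: mat_norm_1) (simp add: column_matrix_def nw)
    also have "\<dots> = 1"
      using dual_column_norm[OF hom on on] by simp
    finally show ?thesis .
  qed
  show ?thesis
  proof (cases "w = 0")
    case True
    have "ip w x = 0" if "x \<in> F" for x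
      using ip_commute[of w x] w that True by simp
    then have "\<phi> g x = 0" "\<phi> 0 x = 0" if "x \<in> F" for x
      using gw cscale[OF g, of x 0] that by simp_all
    moreover have "bounded_functional F (\<lambda>x. 0)"
      by (auto simp: bounded_functional_def intro!: exI[of _ "0::real"])
    moreover have "0 \<in> G"
      using G by (simp add: operator_space_def)
    ultimately have "g = 0"
      using unique[of "\<lambda>x. 0"] g by blast
    with True show ?thesis
      by simp
  next
    case False
    let ?r = "inverse (norm w)"
    have "norm (cscale (complex_of_real ?r) g) = 1"
    proof (rule unit)
      show "cscale (complex_of_real ?r) g \<in> G"
        using G g by (simp add: operator_space_def)
      show "cscale (complex_of_real ?r) w \<in> F"
        using w by simp
      show "\<phi> (cscale (complex_of_real ?r) g) x = ip (cscale (complex_of_real ?r) w) x" if "x \<in> F" for x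
        using that w g by (simp add: cscale gw ip_cscale_left)
      show "norm (cscale (complex_of_real ?r) w) = 1"
        unfolding cscale_of_real using False by simp
    qed
    then show ?thesis
      unfolding cscale_of_real using False by (simp add: field_simps)
  qed
qed

text \<open>The antilinear map that sends a functional to its Riesz vector is isometric, so it preserves
orthonormality by polarization.\<close>

lemma dual_basis:
  fixes G :: "('k::chilbert_space \<Rightarrow>\<^sub>L 'k) set"
  assumes hom: "one_homogeneous F" and dual: "operator_space_dual F G"
    and e: "orthonormal UNIV e" "closure (cspan (range e)) = F" and f: "orthonormal_basis G f"
  obtains v where "orthonormal UNIV v"
    and "\<And>n. mat_norm n (column_matrix f) = cb_norm_into_Mn F n (\<lambda>x. column_matrix (\<lambda>i. ip (v i) x))"
    and "\<And>n. mat_norm n (row_matrix f) = cb_norm_into_Mn F n (\<lambda>x. row_matrix (\<lambda>j. ip (v j) x))"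
proof -
  have G: "operator_space G"
    using dual by (simp add: operator_space_dual_def)
  obtain \<phi> where \<phi>: "\<forall>g\<in>G. bounded_functional F (\<phi> g)"
      "\<forall>g\<in>G. \<forall>g'\<in>G. \<forall>x\<in>F. \<phi> (g + g') x = \<phi> g x + \<phi> g' x"
      "\<forall>c. \<forall>g\<in>G. \<forall>x\<in>F. \<phi> (cscale c g) x = c * \<phi> g x"
      "\<forall>\<psi>. bounded_functional F \<psi> \<longrightarrow> (\<exists>!g. g \<in> G \<and> (\<forall>x\<in>F. \<phi> g x = \<psi> x))"
      "\<forall>n. \<forall>g\<in>matrices_over n G. mat_norm n g = cb_norm_into_Mn F n (\<lambda>x i j. \<phi> (g i j) x)"
    using dual unfolding operator_space_dual_def by (elim conjE exE) (rule that; assumption)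
  note functional = \<phi>(1)[rule_format] and add = \<phi>(2)[rule_format] and cscale = \<phi>(3)[rule_format]
    and unique = \<phi>(4)[rule_format] and norm = \<phi>(5)[rule_format]
  obtain ipG where ipG: "hilbert_inner G ipG"
    and f_ortho: "\<And>j k. ipG (f j) (f k) = (if j = k then 1 else 0)" and fG: "\<And>k. f k \<in> G"
    using f unfolding orthonormal_basis_def by blast
  interpret G: hilbertian_operator_space G ipG
    by standard (rule G ipG)+
  have "\<exists>v\<in>F. \<forall>x\<in>F. \<phi> (f k) x = ip v x" for k
    by (rule riesz_representation[OF functional[OF fG] e])
  then obtain v where vF: "\<And>k. v k \<in> F" and v: "\<And>k x. x \<in> F \<Longrightarrow> \<phi> (f k) x = ip (v k) x"
    by metis
  have isometry: "norm (f j) = norm (v j)" for j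
    by (rule norm_dual_element[OF hom cscale unique norm G fG vF v])
  have "G.orthonormal UNIV f"
    using fG f_ortho by (auto simp: G.orthonormal_def)
  then have norm_f: "norm (f j) = 1" for j
    by (rule G.orthonormal_norm) simp
  \<comment> \<open>polarization: compare \<open>\<parallel>f\<^sub>j + c f\<^sub>k\<parallel>\<^sup>2 = 1 + \<bar>c\<bar>\<^sup>2\<close> with the expansion of \<open>\<parallel>v\<^sub>j + cnj c v\<^sub>k\<parallel>\<^sup>2\<close>\<close>
  have Re_zero: "Re (cnj c * ip (v j) (v k)) = 0" if "j \<noteq> k" for c j k
  proof -
    have "norm (f j + cscale c (f k)) = norm (v j + cscale (cnj c) (v k))"
      by (rule norm_dual_element[OF hom cscale unique norm G])
        (simp_all add: fG vF add cscale v ip_add_left ip_cscale_left)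
    then show ?thesis
      using G.norm_add_cscale[OF fG fG, of j c k] norm_add_cscale[OF vF vF, of j "cnj c" k] that
      by (simp add: f_ortho norm_f isometry[symmetric])
  qed
  have "orthonormal UNIV v"
    unfolding orthonormal_def
  proof (intro conjI ballI)
    fix j k
    show "ip (v j) (v k) = (if j = k then 1 else 0)"
    proof (cases "j = k")
      case True
      then show ?thesis
        by (simp add: ip_self[OF vF] isometry[symmetric] norm_f)
    next
      case False
      then show ?thesis
        using Re_zero[of j k 1] Re_zero[of j k \<i>] by (simp add: complex_eq_iff)
    qed
  qed (use vF in auto)
  moreover have zero: "\<phi> 0 x = 0" if "x \<in> F" for x
    using cscale[OF fG that, of 0 0] by simp
  have "mat_norm n (column_matrix f) = cb_norm_into_Mn F n (\<lambda>x. column_matrix (\<lambda>i. ip (v i) x))" for n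
    by (subst norm, simp add: matrices_over_def column_matrix_def fG, rule cb_norm_into_Mn_cong)
      (simp add: column_matrix_def v zero)
  moreover have "mat_norm n (row_matrix f) = cb_norm_into_Mn F n (\<lambda>x. row_matrix (\<lambda>j. ip (v j) x))" for n
    by (subst norm, simp add: matrices_over_def row_matrix_def fG, rule cb_norm_into_Mn_cong)
      (simp add: row_matrix_def v zero)
  ultimately show thesis
    using that by blast
qed

end

section \<open>The product formula\<close>

theorem theorem3p11:
  fixes F :: "('h::chilbert_space \<Rightarrow>\<^sub>L 'h) set"
    and F_dual :: "('k::chilbert_space \<Rightarrow>\<^sub>L 'k) set"
    and e :: "nat \<Rightarrow> 'h \<Rightarrow>\<^sub>L 'h"
    and e_dual :: "nat \<Rightarrow> 'k \<Rightarrow>\<^sub>L 'k"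
  assumes "operator_space F"
    and "infinite_dimensional F"
    and "separable_space (top_of_set F)"
    and "one_homogeneous F"
    and "one_hilbertian F"
    and "operator_space_dual F F_dual"
    and "orthonormal_basis F e"
    and "orthonormal_basis F_dual e_dual"
  shows "\<forall>n. Phi_c e n * Phi_c e_dual n = real n \<and> Phi_r e n * Phi_r e_dual n = real n"
proof
  fix n
  obtain ip where ip: "hilbert_inner F ip" and e_ortho: "\<And>j k. ip (e j) (e k) = (if j = k then 1 else 0)"
    and eF: "range e \<subseteq> F" and dense: "closure (cspan (range e)) = F"
    using assms(7) unfolding orthonormal_basis_def by blast
  interpret hilbertian_operator_space F ip
    by standard (rule assms(1) ip)+
  have e: "orthonormal A e" for A
    using eF e_ortho by (auto simp: orthonormal_def)
  obtain v where v: "orthonormal UNIV v"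
    and column: "mat_norm n (column_matrix e_dual) = cb_norm_into_Mn F n (\<lambda>x. column_matrix (\<lambda>i. ip (v i) x))"
    and row: "mat_norm n (row_matrix e_dual) = cb_norm_into_Mn F n (\<lambda>x. row_matrix (\<lambda>j. ip (v j) x))"
    using dual_basis[OF assms(4,6) e dense assms(8)] by metis
  have vn: "orthonormal {..<n} v"
    using v by (auto simp: orthonormal_def)
  have "F_dual \<subseteq> BH" "range e_dual \<subseteq> F_dual"
    using assms(6,8) by (simp_all add: operator_space_dual_def operator_space_def orthonormal_basis_def)
  then have BH: "e ` {..<n} \<subseteq> BH" "e_dual ` {..<n} \<subseteq> BH"
    using eF mem_BH by (auto simp: image_subset_iff)
  show "Phi_c e n * Phi_c e_dual n = real n \<and> Phi_r e n * Phi_r e_dual n = real n"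
  proof (cases "n = 0")
    case True
    then show ?thesis
      by (simp add: Phi_c_def Phi_r_def min_tensor_norm_empty)
  next
    case False
    then have n: "0 < n"
      by simp
    have "mat_norm n (column_matrix e) * mat_norm n (column_matrix e_dual) = sqrt (real n)"
      using dual_column_norm[OF assms(4) vn e n] by (simp add: column mult.commute)
    moreover have "mat_norm n (row_matrix e) * mat_norm n (row_matrix e_dual) = sqrt (real n)"
      using dual_row_norm[OF assms(4) vn e n] by (simp add: row mult.commute)
    ultimately show ?thesis
      using BH n by (simp add: Phi_c_eq_column_norm Phi_r_eq_row_norm flip: power_mult_distrib)
  qed
qed

end
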